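(* Let $d\ge 2$ and $d-2\le s<d$. Let $\{x_n\}_{n=1}^\infty\subset\mathbb{S}^d$ be a greedy $s$-energy sequence and $\omega_{N,d}=\{x_1,\dots,x_N\}$. Then the sequence of configurations $\{\omega_{N,d}\}_{N\in\mathbb{N}}$ is well-separated, i.e. there exists a constant $c>0$ such that $\delta(\omega_{N,d})\ge cN^{-1/d}$ for all $N\in\mathbb{N}$.
   Context: $\mathbb{S}^d=\{x\in\mathbb{R}^{d+1}:\|x\|=1\}$ with $\|\cdot\|$ the Euclidean norm. The Riesz $s$-kernel is $K_s(x,y)=\frac1s\|x-y\|^{-s}$ for $s\neq0$ and $K_0(x,y)=-\log\|x-y\|$ (with value $+\infty$ on the diagonal when $s\ge 0$). A greedy $s$-energy sequence $\{x_n\}_{n\ge1}$ on $\mathbb{S}^d$ is obtained by taking an arbitrary $x_1\in\mathbb{S}^d$ and, for each $N\ge1$, choosing $x_{N+1}$ to be any point of $\mathbb{S}^d$ minimizing $x\mapsto\sum_{i=1}^N K_s(x,x_i)$ over $\mathbb{S}^d$. The separation distance of a finite set $\omega_{N,d}=\{x_1,\dots,x_N\}$ is $\delta(\omega_{N,d})=\min_{i\neq j}\|x_i-x_j\|$ (read as $+\infty$ if $N=1$). *)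

theory Defs
  imports "HOL-Analysis.Analysis"
begin

text \<open>
  The kernel is extended-real valued. For \<open>s < 0\<close> the last branch also covers the diagonal, where
  it gives \<open>0\<close> because \<open>0 powr a = 0\<close>.
\<close>

definition riesz_kernel :: "real \<Rightarrow> 'a::real_normed_vector \<Rightarrow> 'a \<Rightarrow> ereal" where
  "riesz_kernel s x y =
     (if s \<ge> 0 \<and> x = y then \<infinity>
      else if s = 0 then ereal (- ln (norm (x - y)))
      else ereal (1 / s * norm (x - y) powr (- s)))"

text \<open>
  Sequences are indexed from \<open>1\<close>; the value at \<open>0\<close> is irrelevant.
\<close>

definition greedy_energy_sequence :: "real \<Rightarrow> (nat \<Rightarrow> 'a::real_normed_vector) \<Rightarrow> bool" where
  "greedy_energy_sequence s x \<longleftrightarrow>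
     x 1 \<in> sphere 0 1 \<and>
     (\<forall>N\<ge>1. is_arg_min (\<lambda>y. \<Sum>i=1..N. riesz_kernel s y (x i)) (\<lambda>y. y \<in> sphere 0 1) (x (N + 1)))"

text \<open>
  The configuration \<open>x 1, \<dots>, x N\<close> is treated as an indexed family, so a repeated point gives
  separation \<open>0\<close>. The index set is finite, so the infimum is a minimum for \<open>N \<ge> 2\<close>; it is
  \<open>\<infinity>\<close> for \<open>N = 1\<close>.
\<close>

definition separation_distance :: "(nat \<Rightarrow> 'a::real_normed_vector) \<Rightarrow> nat \<Rightarrow> ereal" where
  "separation_distance x N =
     (INF (i, j) \<in> {(i, j). i \<in> {1..N} \<and> j \<in> {1..N} \<and> i \<noteq> j}. ereal (norm (x i - x j)))"

definition well_separated :: "nat \<Rightarrow> (nat \<Rightarrow> 'a::real_normed_vector) \<Rightarrow> bool" where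
  "well_separated d x \<longleftrightarrow>
     (\<exists>c>0. \<forall>N\<ge>1. separation_distance x N \<ge> ereal (c * real N powr (- 1 / real d)))"

end

theory Submission
  imports Defs
begin

text \<open>
  Let \<open>e\<close> be the new point, \<open>y\<^sub>1, \<dots>, y\<^sub>N\<close> the old ones and \<open>U\<close> the potential of the old points, so that
  \<open>U \<ge> U e\<close> on the sphere. Integrate this inequality against a measure which smooths the kernel at
  scale \<open>\<surd>t\<close> around \<open>e\<close>. By conformal invariance of the Riesz kernels, the density proportional
  to \<open>(\<bar>x - e\<bar>\<^sup>2 + t) powr - (d - s/2)\<close> has potential \<open>k (\<bar>y - e\<bar>\<^sup>2 + t)\<close> when the kernel is
  \<open>k (\<bar>x - y\<bar>\<^sup>2)\<close>. Since \<open>d - s \<le> 2\<close>, a suitable difference of such densities for \<open>t\<close> and \<open>2 t\<close> is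
  still positive; by convexity its potential is at most the one of the point mass at \<open>e\<close>, and its
  mass differs from that of the point mass by \<open>O(t powr ((d - s)/2))\<close>. Hence the contribution of a
  single \<open>y\<^sub>l\<close> to \<open>U e\<close> is at most \<open>k t + O(t powr (- s/2)) + O(N t powr ((d - s)/2))\<close>, and
  \<open>t = N powr (- 2/d)\<close> gives \<open>\<bar>e - y\<^sub>l\<bar> \<ge> c N powr (- 1/d)\<close>.
\<close>

section \<open>The kernel as a function of the squared distance\<close>

text \<open>At the endpoint s = d - 2 a single smoothed density is not enough: after normalisation
  its mass differs from that of the point mass by an average of first differences of the kernel,
  which there has order t ln(1/t) and would cost a logarithm. Subtracting about half of the density
  at scale 2 t turns these into second differences, whose average is O(t powr ((d - s)/2)) in the
  whole range. Positivity admits weights only up to about 2 powr (-(d - s)/2), and this reaches 1/2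
  precisely when d - s \<le> 2.

  The mass defect enters multiplied by N + s U(e), so the bound N + s U(e) = O(N) is required as
  well; it comes from averaging minimality over a rotation-invariant measure.

  Surface measure on the sphere is avoided. All integrals are over the ambient space against dx/|x|
  with a radial cut-off; there conformal maps of the sphere become boosts, with explicit inverse and
  Jacobian.\<close>

text \<open>
  The Riesz kernel shifted by the constant \<open>-1/s\<close>, which makes it continuous in \<open>s\<close> at \<open>s = 0\<close>
  and lets the logarithmic and the power case be treated by the same formulas. A constant shift does
  not affect the greedy choice.
\<close>

definition kern :: "real \<Rightarrow> real \<Rightarrow> real" where
  "kern s z = (if s = 0 then - ln z / 2 else (z powr (- s / 2) - 1) / s)"

lemma powr_eq_kern: "z > 0 \<Longrightarrow> z powr (- s / 2) = 1 + s * kern s z"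
  by (auto simp: kern_def)

lemma kern_mult:
  assumes "a > 0" "z > 0"
  shows "kern s (a * z) = a powr (- s / 2) * kern s z + kern s a"
  using assms by (simp add: kern_def ln_mult powr_mult add_divide_distrib right_diff_distrib
      diff_divide_distrib)

lemma kern_divide:
  assumes "a > 0" "z > 0"
  shows "a powr (- s / 2) * kern s (z / a) = kern s z - kern s a"
  using kern_mult[of a "z / a" s] assms by simp

lemma kern_deriv:
  assumes "z > 0"
  shows "(kern s has_real_derivative - (z powr (- s / 2 - 1)) / 2) (at z)"
proof (cases "s = 0")
  case True
  have eq: "kern s = (\<lambda>z. - ln z / 2)" using True by (simp add: kern_def fun_eq_iff)
  have "((\<lambda>z. - ln z / 2) has_real_derivative - (1 / z) / 2) (at z)"
    using assms by (auto intro!: derivative_eq_intros)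
  then show ?thesis
    using True assms unfolding eq by (simp add: powr_minus_divide)
next
  case False
  have eq: "kern s = (\<lambda>z. (z powr (- s / 2) - 1) / s)" using False by (simp add: kern_def fun_eq_iff)
  have "((\<lambda>z. (z powr (- s / 2) - 1) / s) has_real_derivative
      ((- s / 2) * z powr (- s / 2 - 1)) / s) (at z)"
    using assms False by (auto intro!: derivative_eq_intros)
  then show ?thesis
    unfolding eq using False by simp
qed

lemma kern_antimono:
  assumes "0 < x" "x \<le> y"
  shows "kern s y \<le> kern s x"
proof (rule DERIV_nonpos_imp_nonincreasing[OF assms(2)])
  fix z assume "x \<le> z" "z \<le> y"
  then show "\<exists>D. (kern s has_real_derivative D) (at z) \<and> D \<le> 0"
    using assms kern_deriv[of z s] by (intro exI[of _ "- (z powr (- s / 2 - 1)) / 2"]) auto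
qed

lemma kern_diff_bounds:
  assumes "s \<ge> 0" "x > 0" "t \<ge> 0"
  shows "t / 2 * (x + t) powr (- s / 2 - 1) \<le> kern s x - kern s (x + t)"
    and "kern s x - kern s (x + t) \<le> t / 2 * x powr (- s / 2 - 1)"
proof -
  have "\<exists>z. x \<le> z \<and> z \<le> x + t \<and> kern s x - kern s (x + t) = t / 2 * z powr (- s / 2 - 1)"
  proof (cases "t = 0")
    case False
    then obtain z where z: "x < z" "z < x + t"
      "kern s (x + t) - kern s x = (x + t - x) * (- (z powr (- s / 2 - 1)) / 2)"
      using MVT2[of x "x + t" "kern s" "\<lambda>z. - (z powr (- s / 2 - 1)) / 2"] assms kern_deriv
      by fastforce
    then show ?thesis by (intro exI[of _ z]) (auto simp: algebra_simps)
  qed auto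
  then obtain z where z: "x \<le> z" "z \<le> x + t"
    and eq: "kern s x - kern s (x + t) = t / 2 * z powr (- s / 2 - 1)" by blast
  have "(x + t) powr (- s / 2 - 1) \<le> z powr (- s / 2 - 1)" "z powr (- s / 2 - 1) \<le> x powr (- s / 2 - 1)"
    using z assms by (auto intro!: powr_mono2')
  then show "t / 2 * (x + t) powr (- s / 2 - 1) \<le> kern s x - kern s (x + t)"
    and "kern s x - kern s (x + t) \<le> t / 2 * x powr (- s / 2 - 1)"
    unfolding eq using assms by (auto intro!: mult_left_mono)
qed

text \<open>Gives up smallness in \<open>t\<close> for a milder singularity: the linear bound
  carries \<open>x powr (- s / 2 - 1)\<close>, which is not integrable near the pole when d - s
  \<le> 2. Scaling by \<open>x\<close> reduces the claim to
  \<open>ln (1 + y) \<le> y powr h / h\<close>.\<close>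

lemma kern_diff_le_powr:
  assumes "s \<ge> 0" "x > 0" "t \<ge> 0" "0 < h" "h \<le> 1"
  shows "kern s x - kern s (x + t) \<le> t powr h / h * x powr (- s / 2 - h)"
proof -
  have ln_le: "ln (1 + y) \<le> y powr h / h" if y: "y \<ge> 0" for y :: real
  proof (cases "y \<le> 1")
    case True
    have "ln (1 + y) \<le> y" using y ln_add_one_self_le_self by simp
    also have "y \<le> y powr h" using powr_mono'[of h 1 y] y True assms by (cases "y = 0") auto
    also have "\<dots> \<le> y powr h / h" using assms by (simp add: le_divide_eq mult_left_le)
    finally show ?thesis .
  next
    case False
    then have y: "y > 1" by simp
    have "ln (1 + y) \<le> ln (2 * y)" using y by simp
    also have "\<dots> = ln 2 + ln y" using y by (simp add: ln_mult)
    also have "ln (2::real) \<le> 1" using ln_add_one_self_le_self[of 1] by simp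
    also have "h * ln y \<le> y powr h - 1" using ln_le_minus_one[of "y powr h"] y by (simp add: ln_powr)
    then have "ln y \<le> (y powr h - 1) / h" using assms by (simp add: field_simps)
    also have "1 + (y powr h - 1) / h \<le> y powr h / h" using assms by (simp add: field_simps)
    finally show ?thesis by simp
  qed
  \<comment> \<open>The logarithmic case dominates all others, by \<open>ln p \<le> p - 1\<close> at
    \<open>p = z powr (- s / 2)\<close>.\<close>
  have neg_kern: "- kern s z \<le> ln z / 2" if "z \<ge> 1" for z
  proof (cases "s = 0")
    case False
    have "z powr (- s / 2) > 0" using that by simp
    then have "ln (z powr (- s / 2)) \<le> z powr (- s / 2) - 1" by (rule ln_le_minus_one)
    then have "- s / 2 * ln z \<le> z powr (- s / 2) - 1" using that by (simp add: ln_powr)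
    then show ?thesis using False assms by (simp add: kern_def field_simps)
  qed (simp add: kern_def)
  have "kern s x - kern s (x + t) = - (x powr (- s / 2) * kern s (1 + t / x))"
  proof -
    have "x * (1 + t / x) = x + t" using assms by (simp add: distrib_left)
    moreover have "1 + t / x > 0" using assms by (simp add: add_pos_nonneg)
    ultimately have "kern s (x + t) = x powr (- s / 2) * kern s (1 + t / x) + kern s x"
      using kern_mult[of x "1 + t / x" s] assms(2) by presburger
    then show ?thesis by linarith
  qed
  also have "\<dots> \<le> x powr (- s / 2) * (ln (1 + t / x) / 2)"
    using mult_left_mono[OF neg_kern[of "1 + t / x"], of "x powr (- s / 2)"] assms by simp
  also have "\<dots> \<le> x powr (- s / 2) * ((t / x) powr h / h)"
  proof (intro mult_left_mono)
    have "ln (1 + t / x) \<ge> 0" using assms by simp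
    moreover have "ln (1 + t / x) \<le> (t / x) powr h / h" using ln_le[of "t / x"] assms by simp
    ultimately show "ln (1 + t / x) / 2 \<le> (t / x) powr h / h" by linarith
  qed simp
  also have "\<dots> = t powr h / h * x powr (- s / 2 - h)"
    using assms by (simp add: powr_divide powr_diff mult_ac)
  finally show ?thesis .
qed

text \<open>The two first differences are compared with derivative values at \<open>x\<close> and
  \<open>x + 2 * t\<close>. The gap between these values is again a first difference, now of
  \<open>kern (s + 2)\<close>, because the derivative of \<open>kern s\<close> is affine in
  \<open>kern (s + 2)\<close>.\<close>

lemma kern_second_diff:
  assumes "s \<ge> 0" "x > 0" "t \<ge> 0"
  shows "(kern s x - kern s (x + t)) - (kern s (x + t) - kern s (x + 2 * t))
           \<le> (s / 2 + 1) * t\<^sup>2 * x powr (- s / 2 - 2)"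
proof -
  have 1: "kern s x - kern s (x + t) \<le> t / 2 * x powr (- s / 2 - 1)"
    by (rule kern_diff_bounds) (use assms in auto)
  have "t / 2 * ((x + t) + t) powr (- s / 2 - 1) \<le> kern s (x + t) - kern s ((x + t) + t)"
    by (rule kern_diff_bounds) (use assms in auto)
  then have 2: "t / 2 * (x + 2 * t) powr (- s / 2 - 1) \<le> kern s (x + t) - kern s (x + 2 * t)"
    by (simp add: add.assoc)
  have 3: "x powr (- s / 2 - 1) - (x + 2 * t) powr (- s / 2 - 1) \<le> 2 * t * (s / 2 + 1) * x powr (- s / 2 - 2)"
  proof -
    define u where "u = x powr (- s / 2 - 1)"
    define v where "v = (x + 2 * t) powr (- s / 2 - 1)"
    define w where "w = x powr (- s / 2 - 2)"
    have e: "- (s + 2) / 2 = - s / 2 - 1" "- s / 2 - 1 - 1 = - s / 2 - 2" by (auto simp: field_simps)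
    have k: "kern (s + 2) z = (z powr (- s / 2 - 1) - 1) / (s + 2)" for z
      using assms unfolding kern_def e by simp
    have "(u - 1) / (s + 2) - (v - 1) / (s + 2) \<le> t * w"
      using kern_diff_bounds(2)[of "s + 2" x "2 * t"] assms unfolding k u_def v_def w_def e by simp
    then have "(u - v) / (s + 2) \<le> t * w" by (simp add: diff_divide_distrib)
    then have "u - v \<le> t * w * (s + 2)" using assms by (simp add: pos_divide_le_eq)
    then show ?thesis unfolding u_def[symmetric] v_def[symmetric] w_def[symmetric] by (simp add: algebra_simps)
  qed
  have "t / 2 * (x powr (- s / 2 - 1) - (x + 2 * t) powr (- s / 2 - 1))
     \<le> t / 2 * (2 * t * (s / 2 + 1) * x powr (- s / 2 - 2))"
    using 3 assms by (intro mult_left_mono) auto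
  then show ?thesis using 1 2 by (simp add: power2_eq_square algebra_simps)
qed

section \<open>Integrals controlled by the size of sublevel sets\<close>

lemma le_suminf: "f k \<le> (\<Sum>k. f k)" for f :: "nat \<Rightarrow> ennreal"
  using sum_le_suminf[of f "{k}"] by simp

text \<open>A layer-cake bound: \<open>h\<close> is dominated by the series of its bounds
  \<open>c k\<close> on sublevel sets of \<open>w\<close>, which is integrated term by term. The
  radii will be dyadic, shrinking near a pole and growing away from it.\<close>

lemma nn_integral_le_level_series:
  fixes w h :: "'a \<Rightarrow> real" and r c :: "nat \<Rightarrow> real"
  assumes [measurable]: "w \<in> borel_measurable M"
    and bound: "\<And>e. e > 0 \<Longrightarrow> emeasure M {x \<in> space M. w x \<le> e} \<le> ennreal (C * e powr a)"
    and "C \<ge> 0" and r: "\<And>k. r k > 0" and c: "\<And>k. c k \<ge> 0"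
    and h: "\<And>x. x \<in> space M \<Longrightarrow> h x > 0 \<Longrightarrow> \<exists>k. w x \<le> r k \<and> h x \<le> c k"
    and S: "(\<lambda>k. c k * (C * r k powr a)) sums S"
  shows "(\<integral>\<^sup>+x. ennreal (h x) \<partial>M) \<le> ennreal S"
proof -
  have "(\<integral>\<^sup>+x. ennreal (h x) \<partial>M) \<le>
      (\<integral>\<^sup>+x. (\<Sum>k. ennreal (c k) * indicator {x \<in> space M. w x \<le> r k} x) \<partial>M)"
  proof (rule nn_integral_mono)
    fix x assume x: "x \<in> space M"
    show "ennreal (h x) \<le> (\<Sum>k. ennreal (c k) * indicator {x \<in> space M. w x \<le> r k} x)"
    proof (cases "h x > 0")
      case True
      then obtain k where k: "w x \<le> r k" "h x \<le> c k" using h x by blast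
      have "ennreal (h x) \<le> ennreal (c k) * indicator {x \<in> space M. w x \<le> r k} x"
        using k x by (simp add: ennreal_leI)
      also have "\<dots> \<le> (\<Sum>k. ennreal (c k) * indicator {x \<in> space M. w x \<le> r k} x)"
        using le_suminf[of "\<lambda>k. ennreal (c k) * indicator {x \<in> space M. w x \<le> r k} x" k] by simp
      finally show ?thesis .
    qed (simp add: ennreal_neg)
  qed
  also have "\<dots> = (\<Sum>k. \<integral>\<^sup>+x. ennreal (c k) * indicator {x \<in> space M. w x \<le> r k} x \<partial>M)"
    by (rule nn_integral_suminf) simp
  also have "\<dots> = (\<Sum>k. ennreal (c k) * emeasure M {x \<in> space M. w x \<le> r k})"
    by (simp add: nn_integral_cmult_indicator)
  also have "\<dots> \<le> (\<Sum>k. ennreal (c k * (C * r k powr a)))"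
  proof (rule suminf_le)
    fix k
    show "ennreal (c k) * emeasure M {x \<in> space M. w x \<le> r k} \<le> ennreal (c k * (C * r k powr a))"
      using mult_left_mono[OF bound[OF r[of k]], of "ennreal (c k)"] c[of k] \<open>C \<ge> 0\<close>
      by (simp add: ennreal_mult)
  qed auto
  also have "\<dots> = ennreal S"
    using c \<open>C \<ge> 0\<close> by (intro suminf_ennreal_eq S) auto
  finally show ?thesis .
qed

lemma dyadic_bracket:
  fixes y :: real
  assumes "y \<ge> 1"
  obtains k :: nat where "2 ^ k \<le> y" "y < 2 ^ Suc k"
proof -
  define k where "k = nat \<lfloor>log 2 y\<rfloor>"
  have l: "log 2 y \<ge> 0" using assms by simp
  have "real k \<le> log 2 y" "log 2 y < real k + 1"
    unfolding k_def using l by linarith+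
  then have "2 powr real k \<le> 2 powr log 2 y" "2 powr log 2 y < 2 powr (real (Suc k))"
    by (auto simp del: powr_log_cancel)
  then show thesis
    using that[of k] assms powr_realpow[of 2 k] powr_realpow[of 2 "Suc k"] by simp
qed

text \<open>The shell between \<open>t / 2 ^ Suc k\<close> and \<open>t / 2 ^ k\<close> contributes
  a term of a geometric series with ratio \<open>2 powr (p - a)\<close>, so the sublevel bound beats
  the singularity exactly because \<open>p < a\<close>.\<close>

lemma nn_integral_powr_sublevel_le:
  fixes w :: "'a \<Rightarrow> real"
  assumes [measurable]: "w \<in> borel_measurable M"
    and bound: "\<And>e. e > 0 \<Longrightarrow> emeasure M {x \<in> space M. w x \<le> e} \<le> ennreal (C * e powr a)"
    and "C \<ge> 0" "0 \<le> p" "p < a" "t > 0"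
  shows "(\<integral>\<^sup>+x. ennreal (if 0 < w x \<and> w x \<le> t then w x powr (- p) else 0) \<partial>M)
           \<le> ennreal (2 powr p * C * t powr (a - p) / (1 - 2 powr (p - a)))"
proof (rule nn_integral_le_level_series[where r = "\<lambda>k. t / 2 ^ k" and
      c = "\<lambda>k. (t / 2 ^ Suc k) powr (- p)" and C = C and a = a and w = w])
  fix x assume "0 < (if 0 < w x \<and> w x \<le> t then w x powr (- p) else 0)"
  then have w: "0 < w x" "w x \<le> t" by (auto split: if_splits)
  then obtain k where k: "2 ^ k \<le> t / w x" "t / w x < 2 ^ Suc k"
    using dyadic_bracket[of "t / w x"] by (auto simp: field_simps)
  have "t / 2 ^ Suc k \<le> w x" "w x \<le> t / 2 ^ k" using k w by (simp_all add: field_simps)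
  then show "\<exists>k. w x \<le> t / 2 ^ k \<and>
      (if 0 < w x \<and> w x \<le> t then w x powr (- p) else 0) \<le> (t / 2 ^ Suc k) powr (- p)"
    using w assms by (intro exI[of _ k]) (auto intro!: powr_mono2')
next
  have "2 powr (p - a) < 1" using assms by (simp add: powr_less_one)
  then have "(\<lambda>k. (2 powr p * C * t powr (a - p)) * (2 powr (p - a)) ^ k) sums
      ((2 powr p * C * t powr (a - p)) * (1 / (1 - 2 powr (p - a))))"
    by (intro sums_mult geometric_sums) auto
  moreover have "(t / 2 ^ Suc k) powr (- p) * (C * (t / 2 ^ k) powr a) =
      (2 powr p * C * t powr (a - p)) * (2 powr (p - a)) ^ k" for k
    using assms by (simp add: powr_divide powr_minus_divide powr_diff powr_mult powr_powr
        power_divide powr_power field_simps flip: powr_realpow)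
  ultimately show "(\<lambda>k. (t / 2 ^ Suc k) powr (- p) * (C * (t / 2 ^ k) powr a)) sums
      (2 powr p * C * t powr (a - p) / (1 - 2 powr (p - a)))"
    by (simp only: mult_1_right times_divide_eq_right)
qed (use assms in auto)

lemma nn_integral_powr_superlevel_le:
  fixes w :: "'a \<Rightarrow> real"
  assumes [measurable]: "w \<in> borel_measurable M"
    and bound: "\<And>e. e > 0 \<Longrightarrow> emeasure M {x \<in> space M. w x \<le> e} \<le> ennreal (C * e powr a)"
    and "C \<ge> 0" "0 \<le> p" "a < p" "t > 0"
  shows "(\<integral>\<^sup>+x. ennreal (if t < w x then w x powr (- p) else 0) \<partial>M)
           \<le> ennreal (2 powr a * C * t powr (a - p) / (1 - 2 powr (a - p)))"
proof (rule nn_integral_le_level_series[where r = "\<lambda>k. t * 2 ^ Suc k" and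
      c = "\<lambda>k. (t * 2 ^ k) powr (- p)" and C = C and a = a and w = w])
  fix x assume "0 < (if t < w x then w x powr (- p) else 0)"
  then have w: "t < w x" by (auto split: if_splits)
  then obtain k where k: "2 ^ k \<le> w x / t" "w x / t < 2 ^ Suc k"
    using dyadic_bracket[of "w x / t"] assms by (auto simp: field_simps)
  have "t * 2 ^ k \<le> w x" "w x \<le> t * 2 ^ Suc k" using k w assms by (simp_all add: field_simps)
  then show "\<exists>k. w x \<le> t * 2 ^ Suc k \<and>
      (if t < w x then w x powr (- p) else 0) \<le> (t * 2 ^ k) powr (- p)"
    using w assms by (intro exI[of _ k]) (auto intro!: powr_mono2')
next
  have "2 powr (a - p) < 1" using assms by (simp add: powr_less_one)
  then have "(\<lambda>k. (2 powr a * C * t powr (a - p)) * (2 powr (a - p)) ^ k) sums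
      ((2 powr a * C * t powr (a - p)) * (1 / (1 - 2 powr (a - p))))"
    by (intro sums_mult geometric_sums) auto
  moreover have "(t * 2 ^ k) powr (- p) * (C * (t * 2 ^ Suc k) powr a) =
      (2 powr a * C * t powr (a - p)) * (2 powr (a - p)) ^ k" for k
    using assms by (simp add: powr_divide powr_minus_divide powr_diff powr_mult powr_powr
        power_divide powr_power field_simps flip: powr_realpow)
  ultimately show "(\<lambda>k. (t * 2 ^ k) powr (- p) * (C * (t * 2 ^ Suc k) powr a)) sums
      (2 powr a * C * t powr (a - p) / (1 - 2 powr (a - p)))"
    by (simp only: mult_1_right times_divide_eq_right)
qed (use assms in auto)

section \<open>Boosts of the light cone\<close>

text \<open>
  A vector \<open>x\<close> stands for the null vector \<open>(\<bar>x\<bar>, x)\<close> of Minkowski space: \<open>dx / \<bar>x\<bar>\<close> is the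
  Lorentz-invariant measure on the light cone, and \<open>minkowski\<close> is the Lorentzian product of two
  null vectors. For unit vectors, \<open>\<bar>x - y\<bar>\<^sup>2 = 2 minkowski x y\<close>.
\<close>

definition cone_measure :: "'a::euclidean_space measure" where
  "cone_measure = density lborel (\<lambda>x. ennreal (1 / norm x))"

definition minkowski :: "'a::real_inner \<Rightarrow> 'a \<Rightarrow> real" where
  "minkowski x y = norm x * norm y - x \<bullet> y"

section \<open>Change of variables on the punctured space\<close>

lemma has_bochner_integral_iff_change_of_variables:
  fixes g g' :: "real^'m::{finite,wellorder} \<Rightarrow> real^'m::{finite,wellorder}"
    and h F :: "real^'m::{finite,wellorder} \<Rightarrow> real" 
  assumes der: "\<And>x. x \<noteq> 0 \<Longrightarrow> (g has_derivative G x) (at x)"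
    and gh: "\<And>x. x \<noteq> 0 \<Longrightarrow> g x \<noteq> 0 \<and> k (g x) = x"
    and hg: "\<And>x. x \<noteq> 0 \<Longrightarrow> k x \<noteq> 0 \<and> g (k x) = x"
    and k: "continuous_on (- {0}) k"
  shows "has_bochner_integral lebesgue (\<lambda>x. indicator (- {0}) x * (\<bar>det (matrix (G x))\<bar> * F (g x))) b \<longleftrightarrow>
         has_bochner_integral lebesgue (\<lambda>x. indicator (- {0}) x * F x) b"
proof -
  have img: "g ` (- {0}) = - {0}"
  proof (intro equalityI subsetI)
    fix x assume "x \<in> - {0 :: real^'m::{finite,wellorder}}"
    then show "x \<in> g ` (- {0})" using hg[of x] by (intro image_eqI[of _ _ "k x"]) auto
  qed (use gh in auto)
  have eq: "(f absolutely_integrable_on - {0} \<and> integral (- {0}) f = b) =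
     has_bochner_integral lebesgue (\<lambda>x. indicator (- {0}) x * f x) b" 
     for f :: "real^'m::{finite,wellorder} \<Rightarrow> real"
  proof -
    have "integral (- {0}) f = integral\<^sup>L lebesgue (\<lambda>x. indicator (- {0}) x * f x)"
      if "f absolutely_integrable_on - {0}"
      using set_lebesgue_integral_eq_integral(2)[OF that] by (simp add: set_lebesgue_integral_def)
    moreover have "f absolutely_integrable_on - {0} \<longleftrightarrow> integrable lebesgue (\<lambda>x. indicator (- {0}) x * f x)"
      by (simp add: set_integrable_def)
    ultimately show ?thesis unfolding has_bochner_integral_iff by argo
  qed
  \<comment> \<open>The change of variables formula concerns vector-valued integrands, hence the
    passage through \<open>real ^ 1\<close>.\<close>
  have "(\<lambda>x. \<bar>det (matrix (G x))\<bar> *\<^sub>R vec (F (g x)) :: real ^ 1) absolutely_integrable_on - {0} \<and>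
         integral (- {0}) (\<lambda>x. \<bar>det (matrix (G x))\<bar> *\<^sub>R vec (F (g x)) :: real ^ 1) = (vec b :: real ^ 1)
     \<longleftrightarrow> (\<lambda>x. vec (F x) :: real ^ 1) absolutely_integrable_on (g ` (- {0})) \<and>
         integral (g ` (- {0})) (\<lambda>x. vec (F x) :: real ^ 1) = vec b"
  proof (rule has_absolute_integral_change_of_variables_invertible)
    show "(g has_derivative G x) (at x within - {0})" if "x \<in> - {0}" for x
      using der that by (simp add: has_derivative_at_withinI)
    show "k (g x) = x" if "x \<in> - {0}" for x using gh that by simp
    show "continuous_on (g ` (- {0})) k" unfolding img by (rule k)
  qed
  then have "(\<lambda>x. \<bar>det (matrix (G x))\<bar> * F (g x)) absolutely_integrable_on - {0} \<and>
         integral (- {0}) (\<lambda>x. \<bar>det (matrix (G x))\<bar> * F (g x)) = b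
     \<longleftrightarrow> F absolutely_integrable_on (- {0}) \<and> integral (- {0}) F = b"
    unfolding img absolutely_integrable_on_1_iff integral_on_1_eq by (simp add: vec_eq_iff)
  then show ?thesis by (simp add: eq)
qed

text \<open>Since the equivalence holds for every \<open>b\<close>, integrability itself transfers
  in both directions, so the two sides are infinite together.\<close>

lemma nn_integral_eqI_has_bochner_integral:
  fixes f g :: "'a \<Rightarrow> real"
  assumes [measurable]: "f \<in> borel_measurable M" "g \<in> borel_measurable N"
    and "\<And>x. f x \<ge> 0" "\<And>x. g x \<ge> 0"
    and "\<And>b. has_bochner_integral M f b \<longleftrightarrow> has_bochner_integral N g b"
  shows "(\<integral>\<^sup>+x. ennreal (f x) \<partial>M) = (\<integral>\<^sup>+x. ennreal (g x) \<partial>N)"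
proof (cases "integrable M f")
  case True
  then have "integrable N g" "integral\<^sup>L M f = integral\<^sup>L N g"
    using assms(5)[of "integral\<^sup>L M f"] by (auto simp: has_bochner_integral_iff)
  then show ?thesis using True assms by (simp add: nn_integral_eq_integral)
next
  case False
  then have "\<not> integrable N g"
    using assms(5)[of "integral\<^sup>L N g"] by (auto simp: has_bochner_integral_iff)
  then show ?thesis
    using False assms by (auto simp: integrable_iff_bounded not_less top_unique)
qed

text \<open>The condition on the determinant says that \<open>g\<close> pulls
  \<open>dx / norm x\<close> back to \<open>c\<close> times itself. This criterion serves boosts and
  rotations alike; the origin is excluded because \<open>norm\<close> is not differentiable
  there.\<close>

lemma distr_cone:
  fixes g k :: "real^'m::{finite,wellorder} \<Rightarrow> real^'m::{finite,wellorder}"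
  assumes der: "\<And>x. x \<noteq> 0 \<Longrightarrow> (g has_derivative G x) (at x)"
    and gh: "\<And>x. x \<noteq> 0 \<Longrightarrow> g x \<noteq> 0 \<and> k (g x) = x"
    and hg: "\<And>x. x \<noteq> 0 \<Longrightarrow> k x \<noteq> 0 \<and> g (k x) = x"
    and k: "continuous_on (- {0}) k"
    and [measurable]: "g \<in> borel_measurable borel"
    and det: "\<And>x. x \<noteq> 0 \<Longrightarrow> \<bar>det (matrix (G x))\<bar> = c * norm (g x) / norm x"
    and "c > 0"
  shows "distr cone_measure borel g = density cone_measure (\<lambda>_. ennreal (1 / c))"
proof (rule measure_eqI)
  fix A :: "(real^'m::{finite,wellorder}) set" assume "A \<in> sets (distr cone_measure borel g)"
  then have [measurable]: "A \<in> sets borel" by simp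
  define f where "f = (\<lambda>x. indicator A (g x) / norm x :: real)"
  define F where "F = (\<lambda>x. 1 / c * indicator A x / norm x :: real)"
  have [measurable]: "f \<in> borel_measurable borel" "F \<in> borel_measurable borel"
    unfolding f_def F_def by measurable
  have "emeasure (distr cone_measure borel g) A = (\<integral>\<^sup>+x. indicator A (g x) \<partial>cone_measure)"
  proof -
    have "emeasure (distr cone_measure borel g) A = (\<integral>\<^sup>+x. indicator A x \<partial>distr cone_measure borel g)" by simp
    also have "\<dots> = (\<integral>\<^sup>+x. indicator A (g x) \<partial>cone_measure)"
      by (rule nn_integral_distr) (auto simp: cone_measure_def)
    finally show ?thesis .
  qed
  also have "\<dots> = (\<integral>\<^sup>+x. ennreal (f x) \<partial>lborel)"
    unfolding cone_measure_def f_def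
    by (subst nn_integral_density) (auto intro!: nn_integral_cong simp: indicator_def)
  also have "\<dots> = (\<integral>\<^sup>+x. ennreal (F x) \<partial>lborel)"
  proof -
    have "(\<integral>\<^sup>+x. ennreal (f x) \<partial>lebesgue) = (\<integral>\<^sup>+x. ennreal (F x) \<partial>lebesgue)"
    proof (rule nn_integral_eqI_has_bochner_integral)
      fix b
      have e1: "(\<lambda>x. indicator (- {0}) x * (\<bar>det (matrix (G x))\<bar> * F (g x))) = f"
      proof
        fix x show "indicator (- {0}) x * (\<bar>det (matrix (G x))\<bar> * F (g x)) = f x"
        proof (cases "x = 0")
          case False
          then show ?thesis using gh[of x] det[of x] \<open>c > 0\<close> by (simp add: f_def F_def)
        qed (simp add: f_def)
      qed
      have e2: "(\<lambda>x. indicator (- {0}) x * F x) = F"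
        by (auto simp: F_def fun_eq_iff indicator_def)
      show "has_bochner_integral lebesgue f b \<longleftrightarrow> has_bochner_integral lebesgue F b"
        using has_bochner_integral_iff_change_of_variables[OF der gh hg k, where F = F and b = b]
        unfolding e1 e2 by simp
    qed (use \<open>c > 0\<close> in \<open>auto intro!: measurable_completion simp: f_def F_def\<close>)
    then show ?thesis by (simp add: nn_integral_completion)
  qed
  also have "\<dots> = (\<integral>\<^sup>+x. ennreal (1 / c) * indicator A x \<partial>cone_measure)"
    unfolding cone_measure_def F_def using \<open>c > 0\<close>
    by (subst nn_integral_density)
      (auto intro!: nn_integral_cong simp: indicator_def simp flip: ennreal_mult)
  also have "\<dots> = emeasure (density cone_measure (\<lambda>_. ennreal (1 / c))) A"
    by (subst emeasure_density) (auto simp: cone_measure_def)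
  finally show "emeasure (distr cone_measure borel g) A = emeasure (density cone_measure (\<lambda>_. ennreal (1 / c))) A" .
qed (simp add: cone_measure_def)

text \<open>
  A Lorentz boost in the direction of the \<open>i\<close>-th axis \<open>e\<close>, scaled by \<open>\<surd>(t (4 + t))\<close> so that
  \<open>\<bar>boost i t y\<bar> = \<bar>y - e\<bar>\<^sup>2 + t\<close> for unit vectors \<open>y\<close>.
\<close>

definition boost :: "'n \<Rightarrow> real \<Rightarrow> real^'n \<Rightarrow> real^'n" where
  "boost i t x = (\<chi> j. if j = i then (2 + t) * x $ i - 2 * norm x else sqrt (t * (4 + t)) * x $ j)"

lemma inner_vec_split: "(x::real^'n) \<bullet> y = x $ i * y $ i + (\<Sum>j\<in>UNIV - {i}. x $ j * y $ j)"
  by (simp add: inner_vec_def sum.remove[of UNIV i])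

lemma power2_norm_split: "(norm (x::real^'n))\<^sup>2 = (x $ i)\<^sup>2 + (\<Sum>j\<in>UNIV - {i}. x $ j * x $ j)"
  unfolding power2_norm_eq_inner inner_vec_split[of x x i] by (simp add: power2_eq_square)

lemma sqrt_mult_sqrt_mult:
  assumes "D \<ge> 0"
  shows "sqrt D * a * (sqrt D * b) = D * (a * b)"
proof -
  have "sqrt D * a * (sqrt D * b) = (sqrt D * sqrt D) * (a * b)" by (simp only: mult_ac)
  then show ?thesis using assms by simp
qed

text \<open>Boosts map null vectors to null vectors: the squared length is the perfect square of the
  new time component, which is non-negative because \<open>x $ i \<le> norm x\<close>.\<close>

lemma norm_boost:
  assumes "t \<ge> 0"
  shows "norm (boost i t x) = (2 + t) * norm x - 2 * x $ i"
proof -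
  define S where "S = (\<Sum>j\<in>UNIV - {i}. x $ j * x $ j)"
  have S: "S = (norm x)\<^sup>2 - (x $ i)\<^sup>2" using power2_norm_split[of x i] by (simp add: S_def)
  have "(\<Sum>j\<in>UNIV - {i}. boost i t x $ j * boost i t x $ j) = (\<Sum>j\<in>UNIV - {i}. t * (4 + t) * (x $ j * x $ j))"
    using assms by (intro sum.cong) (simp_all add: boost_def sqrt_mult_sqrt_mult)
  also have "\<dots> = t * (4 + t) * S" by (simp add: S_def sum_distrib_left)
  finally have "(norm (boost i t x))\<^sup>2 = ((2 + t) * x $ i - 2 * norm x)\<^sup>2 + t * (4 + t) * S"
    using power2_norm_split[of "boost i t x" i] by (simp add: boost_def)
  also have "\<dots> = ((2 + t) * norm x - 2 * x $ i)\<^sup>2"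
    unfolding S by (simp add: power2_eq_square algebra_simps)
  finally have "(norm (boost i t x))\<^sup>2 = ((2 + t) * norm x - 2 * x $ i)\<^sup>2" .
  moreover have "(2 + t) * norm x - 2 * x $ i \<ge> 0"
  proof -
    have "norm x - x $ i \<ge> 0" using component_le_norm_cart[of x i] by linarith
    moreover have "t * norm x \<ge> 0" using assms by simp
    ultimately show ?thesis by (simp add: algebra_simps)
  qed
  ultimately show ?thesis by (simp add: power2_eq_iff_nonneg)
qed

text \<open>Unscaled boosts preserve the Lorentzian product; the factor is the square of the scaling
  \<open>sqrt (t * (4 + t))\<close>.\<close>

lemma minkowski_boost:
  assumes "t \<ge> 0"
  shows "minkowski (boost i t x) (boost i t y) = t * (4 + t) * minkowski x y"
proof -
  define S where "S = (\<Sum>j\<in>UNIV - {i}. x $ j * y $ j)"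
  have "(\<Sum>j\<in>UNIV - {i}. boost i t x $ j * boost i t y $ j) = (\<Sum>j\<in>UNIV - {i}. t * (4 + t) * (x $ j * y $ j))"
    using assms by (intro sum.cong) (simp_all add: boost_def sqrt_mult_sqrt_mult)
  also have "\<dots> = t * (4 + t) * S" by (simp add: S_def sum_distrib_left)
  finally have "boost i t x \<bullet> boost i t y =
      ((2 + t) * x $ i - 2 * norm x) * ((2 + t) * y $ i - 2 * norm y) + t * (4 + t) * S"
    unfolding inner_vec_split[of _ _ i] by (simp add: boost_def)
  moreover have "x \<bullet> y = x $ i * y $ i + S" by (simp add: inner_vec_split[of x y i] S_def)
  ultimately show ?thesis
    unfolding minkowski_def norm_boost[OF assms] by (simp add: algebra_simps)
qed

text \<open>The boost of equal rapidity in the opposite direction, with the scaling undone.\<close>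

definition unboost :: "'n \<Rightarrow> real \<Rightarrow> real^'n \<Rightarrow> real^'n" where
  "unboost i t z = (\<chi> j. if j = i then ((2 + t) * z $ i + 2 * norm z) / (t * (4 + t))
                          else z $ j / sqrt (t * (4 + t)))"

lemma norm_unboost:
  assumes "t > 0"
  shows "norm (unboost i t z) = ((2 + t) * norm z + 2 * z $ i) / (t * (4 + t))"
proof -
  define D where "D = t * (4 + t)"
  have D: "D > 0" "D = (2 + t)\<^sup>2 - 4"
    using assms by (simp add: D_def) (simp add: D_def power2_eq_square distrib_left distrib_right)
  define S where "S = (\<Sum>j\<in>UNIV - {i}. z $ j * z $ j)"
  have S: "S = (norm z)\<^sup>2 - (z $ i)\<^sup>2" using power2_norm_split[of z i] by (simp add: S_def)
  have "(\<Sum>j\<in>UNIV - {i}. unboost i t z $ j * unboost i t z $ j) = (\<Sum>j\<in>UNIV - {i}. z $ j * z $ j / D)"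
    using D by (intro sum.cong) (auto simp: unboost_def D_def[symmetric])
  also have "\<dots> = S / D" by (simp add: S_def sum_divide_distrib)
  finally have "(norm (unboost i t z))\<^sup>2 = (((2 + t) * z $ i + 2 * norm z) / D)\<^sup>2 + S / D"
    using power2_norm_split[of "unboost i t z" i] by (simp add: unboost_def D_def[symmetric])
  also have "\<dots> = (((2 + t) * z $ i + 2 * norm z)\<^sup>2 + D * S) / D\<^sup>2"
  proof -
    have "S / D = D * S / D\<^sup>2" using D(1) by (simp add: power2_eq_square)
    then show ?thesis by (metis power_divide add_divide_distrib)
  qed
  also have "((2 + t) * z $ i + 2 * norm z)\<^sup>2 + D * S = ((2 + t) * norm z + 2 * z $ i)\<^sup>2"
    unfolding S D(2) by (simp add: power2_eq_square algebra_simps)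
  finally have "(norm (unboost i t z))\<^sup>2 = (((2 + t) * norm z + 2 * z $ i) / D)\<^sup>2"
    by (simp add: power_divide)
  moreover have "(2 + t) * norm z + 2 * z $ i \<ge> 0"
  proof -
    have "norm z + z $ i \<ge> 0" using component_le_norm_cart[of z i] by linarith
    moreover have "t * norm z \<ge> 0" using assms by simp
    ultimately show ?thesis by (simp add: algebra_simps)
  qed
  ultimately show ?thesis using D(1) by (simp add: power2_eq_iff_nonneg D_def[symmetric])
qed

lemma unboost_boost:
  assumes "t > 0"
  shows "unboost i t (boost i t x) = x" "boost i t (unboost i t x) = x"
proof -
  define D where "D = t * (4 + t)"
  have D: "D > 0" "D = (2 + t)\<^sup>2 - 4"
    using assms by (simp add: D_def) (simp add: D_def power2_eq_square distrib_left distrib_right)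
  have "unboost i t (boost i t x) $ j = x $ j" for j
  proof (cases "j = i")
    case True
    have "(2 + t) * ((2 + t) * x $ i - 2 * norm x) + 2 * ((2 + t) * norm x - 2 * x $ i) = D * x $ i"
      unfolding D(2) by (simp add: power2_eq_square algebra_simps)
    then have "((2 + t) * ((2 + t) * x $ i - 2 * norm x) + 2 * ((2 + t) * norm x - 2 * x $ i)) / D = x $ i"
      using D(1) by simp
    then show ?thesis using True norm_boost[of t i x] assms
      by (simp add: unboost_def D_def) (simp add: boost_def)
  next
    case False
    then show ?thesis using assms by (simp add: unboost_def boost_def)
  qed
  then show "unboost i t (boost i t x) = x" by (simp add: vec_eq_iff)
  have "boost i t (unboost i t x) $ j = x $ j" for j
  proof (cases "j = i")
    case True
    have "(2 + t) * ((2 + t) * x $ i + 2 * norm x) - 2 * ((2 + t) * norm x + 2 * x $ i) = D * x $ i"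
      unfolding D(2) by (simp add: power2_eq_square algebra_simps)
    then have "(2 + t) * (((2 + t) * x $ i + 2 * norm x) / D) - 2 * (((2 + t) * norm x + 2 * x $ i) / D) = x $ i"
      using D(1) by (simp add: field_simps)
    then show ?thesis using True norm_unboost[of t i x] assms
      by (simp add: boost_def D_def) (simp add: unboost_def)
  next
    case False
    then show ?thesis using assms by (simp add: unboost_def boost_def)
  qed
  then show "boost i t (unboost i t x) = x" by (simp add: vec_eq_iff)
qed

definition dboost :: "'n \<Rightarrow> real \<Rightarrow> real^'n \<Rightarrow> real^'n \<Rightarrow> real^'n" where
  "dboost i t x v = (\<chi> j. if j = i then (2 + t) * v $ i - 2 * (x \<bullet> v / norm x) else sqrt (t * (4 + t)) * v $ j)"

lemma has_derivative_boost:
  assumes "x \<noteq> 0"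
  shows "(boost i t has_derivative dboost i t x) (at x)"
proof -
  have n: "(norm has_derivative (\<lambda>v. x \<bullet> v / norm x)) (at x)"
    using has_derivative_norm[OF assms] by (simp add: sgn_div_norm divide_inverse inner_commute mult.commute)
  have "((\<lambda>x. boost i t x $ j) has_derivative (\<lambda>v. dboost i t x v $ j)) (at x)" for j
  proof (cases "j = i")
    case True
    have "((\<lambda>x. (2 + t) * x $ i - 2 * norm x) has_derivative
        (\<lambda>v. (2 + t) * v $ i - 2 * (x \<bullet> v / norm x))) (at x)"
      by (intro derivative_intros n has_derivative_mult_right bounded_linear.has_derivative[OF bounded_linear_vec_nth])
    then show ?thesis using True by (simp add: boost_def dboost_def)
  next
    case False
    have "((\<lambda>x. sqrt (t * (4 + t)) * x $ j) has_derivative (\<lambda>v. sqrt (t * (4 + t)) * v $ j)) (at x)"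
      by (intro has_derivative_mult_right bounded_linear.has_derivative[OF bounded_linear_vec_nth] has_derivative_ident)
    then show ?thesis using False by (simp add: boost_def dboost_def)
  qed
  then show ?thesis
    by (subst has_derivative_componentwise_within) (auto simp: Basis_vec_def inner_axis)
qed

text \<open>Only row \<open>i\<close> of the Jacobian differs from \<open>sqrt (t * (4 + t))\<close>
  times the identity, so Cramer's rule applies; the diagonal entry of that row is
  \<open>norm (boost i t x) / norm x\<close>.\<close>

lemma det_dboost:
  fixes x :: "real^'n"
  assumes "t > 0" "x \<noteq> 0"
  shows "det (matrix (dboost i t x)) = sqrt (t * (4 + t)) ^ (CARD('n) - 1) * norm (boost i t x) / norm x"
proof -
  define r where "r = sqrt (t * (4 + t))"
  have r: "r > 0" using assms by (simp add: r_def)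
  define A :: "real^'n^'n" where "A = mat r"
  define c :: "real^'n" where "c = (\<chi> l. ((if l = i then 2 + t else 0) - 2 * x $ l / norm x) / r)"
  have row: "row j A = r *s axis j 1" for j
    by (auto simp: A_def row_def mat_def axis_def vec_eq_iff)
  have "matrix (dboost i t x) = (\<chi> j. if j = i then sum (\<lambda>l. c $ l *s row l A) UNIV else row j A)"
  proof -
    have c: "(\<Sum>m\<in>UNIV. c $ m *s row m A) $ l = (if l = i then 2 + t else 0) - 2 * x $ l / norm x" for l
    proof -
      have "(\<Sum>m\<in>UNIV. c $ m *s row m A) $ l = (\<Sum>m\<in>UNIV. if m = l then c $ m * r else 0)"
        unfolding row sum_component by (rule sum.cong) (auto simp: axis_def)
      also have "\<dots> = c $ l * r" by simp
      finally show ?thesis using r by (simp add: c_def)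
    qed
    have "matrix (dboost i t x) $ j $ l =
      (if j = i then sum (\<lambda>l. c $ l *s row l A) UNIV else row j A) $ l" for j l
    proof (cases "j = i")
      case True
      have "x \<bullet> axis l 1 = x $ l" "axis l (1::real) $ i = (if l = i then 1 else 0)"
        by (simp_all add: inner_axis) (simp add: axis_def)
      then show ?thesis using c[of l] True by (simp add: matrix_def dboost_def)
    next
      case False
      then show ?thesis by (auto simp: row matrix_def dboost_def r_def[symmetric] axis_def)
    qed
    then show ?thesis by (simp add: vec_eq_iff)
  qed
  then have "det (matrix (dboost i t x)) = c $ i * det A"
    using cramer_lemma_transpose[of i c A] by simp
  also have "det A = r ^ CARD('n)"
    unfolding A_def by (subst det_diagonal) (auto simp: mat_def)
  also have "c $ i * r ^ CARD('n) = r ^ (CARD('n) - 1) * ((2 + t) - 2 * x $ i / norm x)"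
  proof -
    have "r ^ CARD('n) = r ^ (CARD('n) - 1) * r" using power_minus_mult[of "CARD('n)" r] by simp
    then show ?thesis using r by (simp add: c_def)
  qed
  also have "\<dots> = r ^ (CARD('n) - 1) * norm (boost i t x) / norm x"
    using assms by (simp add: norm_boost field_simps)
  finally show ?thesis by (simp add: r_def)
qed

lemma measurable_boost [measurable]: "boost i t \<in> borel_measurable borel"
proof -
  have "continuous_on UNIV (\<lambda>x. boost i t x $ j)" for j
    by (cases "j = i") (auto simp: boost_def intro!: continuous_intros)
  then have "continuous_on UNIV (boost i t)"
    using continuous_on_vec_lambda[of UNIV "\<lambda>j x. boost i t x $ j"] by simp
  then show ?thesis by (rule borel_measurable_continuous_onI)
qed

section \<open>Invariance of the cone measure\<close>

lemma distr_cone_boost: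
  fixes i :: "'m::{finite,wellorder}"
  assumes "t > 0"
  shows "distr cone_measure borel (boost i t) = density cone_measure (\<lambda>_. ennreal (1 / sqrt (t * (4 + t)) ^ (CARD('m) - 1)))"
proof (rule distr_cone[where k = "unboost i t" and G = "dboost i t"])
  have b0: "boost i t 0 = 0" "unboost i t 0 = (0::real^'m::{finite,wellorder})"
    by (auto simp: boost_def unboost_def vec_eq_iff)
  show "boost i t x \<noteq> 0 \<and> unboost i t (boost i t x) = x" if "x \<noteq> 0" for x
    using that unboost_boost[OF assms, of i x] b0 by metis
  show "unboost i t x \<noteq> 0 \<and> boost i t (unboost i t x) = x" if "x \<noteq> 0" for x
    using that unboost_boost[OF assms, of i x] b0 by metis
  have "continuous_on (- {0}) (\<lambda>x. unboost i t x $ j)" for j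
    using assms by (cases "j = i") (auto simp: unboost_def intro!: continuous_intros)
  then show "continuous_on (- {0}) (unboost i t)"
    using continuous_on_vec_lambda[of "- {0}" "\<lambda>j x. unboost i t x $ j"] by simp
  show "\<bar>det (matrix (dboost i t x))\<bar> = sqrt (t * (4 + t)) ^ (CARD('m) - 1) * norm (boost i t x) / norm x"
    if "x \<noteq> 0" for x
    using that assms by (simp add: det_dboost abs_mult)
qed (use assms has_derivative_boost in auto)

lemma distr_cone_orthogonal:
  fixes f :: "real^'m::{finite,wellorder} \<Rightarrow> real^'m::{finite,wellorder}"
  assumes f: "orthogonal_transformation f"
  shows "distr cone_measure borel f = cone_measure"
proof -
  have lin: "linear f" and inv: "orthogonal_transformation (inv f)" and bij: "bij f"
    using f orthogonal_transformation_inv orthogonal_transformation_linear orthogonal_transformation_bij by auto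
  have "distr cone_measure borel f = density cone_measure (\<lambda>_. ennreal (1 / 1))"
  proof (rule distr_cone[where k = "inv f" and G = "\<lambda>_. f"])
    show "f x \<noteq> 0 \<and> inv f (f x) = x" if "x \<noteq> 0" for x
      using that bij f by (metis bij_inv_eq_iff norm_eq_zero orthogonal_transformation_norm)
    show "inv f x \<noteq> 0 \<and> f (inv f x) = x" if "x \<noteq> 0" for x
      using that bij f by (metis bij_inv_eq_iff norm_eq_zero orthogonal_transformation_norm)
    show "continuous_on (- {0}) (inv f)"
      using inv orthogonal_transformation_linear linear_continuous_on linear_conv_bounded_linear by blast
    show "f \<in> borel_measurable borel"
      using lin linear_continuous_on linear_conv_bounded_linear borel_measurable_continuous_onI by blast
    show "\<bar>det (matrix f)\<bar> = 1 * norm (f x) / norm x" if "x \<noteq> 0" for x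
      using that f orthogonal_transformation_det[OF f] by (simp add: orthogonal_transformation_norm)
    show "(f has_derivative f) (at x)" for x
      using lin by (simp add: linear_imp_has_derivative)
  qed auto
  then show ?thesis by (simp add: density_1)
qed

section \<open>The cone measure on the unit ball and caps of the sphere\<close>

definition cone_ball_measure :: "'a::euclidean_space measure" where
  "cone_ball_measure = density cone_measure (\<lambda>x. ennreal (indicat_real (cball 0 1) x))"

text \<open>Write \<open>x = r *\<^sub>R w\<close> with \<open>norm w = 1\<close> and
  \<open>e = axis i 1\<close>. The cut-off reads
  \<open>r * ((norm (w - e))\<^sup>2 + t) \<le> 1\<close>, and integrating the weight
  \<open>r powr (- s / 2)\<close> against \<open>r ^ (d - 1)\<close> yields, up to a factor, the
  density \<open>((norm (w - e))\<^sup>2 + t) powr (- (d - s / 2))\<close> on the sphere.\<close>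

definition boosted_measure :: "'n \<Rightarrow> real \<Rightarrow> (real^'n) measure" where
  "boosted_measure i t = density cone_measure (\<lambda>x. ennreal (indicat_real (cball 0 1) (boost i t x)))"

lemma sets_cone [simp, measurable_cong]: "sets cone_measure = sets borel"
  by (simp add: cone_measure_def)

lemma space_cone [simp]: "space cone_measure = UNIV"
  by (simp add: cone_measure_def)

lemma sets_cone_ball [simp, measurable_cong]: "sets cone_ball_measure = sets borel"
  by (simp add: cone_ball_measure_def)

lemma space_cone_ball [simp]: "space cone_ball_measure = UNIV"
  by (simp add: cone_ball_measure_def)

lemma sets_boosted [simp, measurable_cong]: "sets (boosted_measure i t) = sets borel"
  by (simp add: boosted_measure_def)

lemma space_boosted [simp]: "space (boosted_measure i t) = UNIV"
  by (simp add: boosted_measure_def)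

lemma borel_measurable_indicator_cball [measurable, simp]:
  "indicat_real (cball 0 1) \<in> borel_measurable (borel :: 'a::euclidean_space measure)"
  by (rule borel_measurable_indicator) simp

lemma distr_cone_ball_orthogonal:
  fixes f :: "real^'m::{finite,wellorder} \<Rightarrow> real^'m::{finite,wellorder}"
  assumes f: "orthogonal_transformation f"
  shows "distr cone_ball_measure borel f = cone_ball_measure"
proof -
  have [measurable]: "f \<in> borel_measurable borel"
    using f orthogonal_transformation_linear linear_continuous_on linear_conv_bounded_linear
      borel_measurable_continuous_onI by blast
  define g where "g = (\<lambda>x::real^'m::{finite,wellorder}. ennreal (indicat_real (cball 0 1) x))"
  have [measurable]: "g \<in> borel_measurable borel"
    unfolding g_def by (simp add: borel_measurable_indicator)
  have "g \<circ> f = g" using f by (auto simp: g_def fun_eq_iff indicator_def orthogonal_transformation_norm)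
  then have "distr cone_ball_measure borel f = density (distr cone_measure borel f) g"
    by (subst density_distr) (auto simp: cone_ball_measure_def g_def comp_def)
  then show ?thesis using distr_cone_orthogonal[OF f] by (simp add: cone_ball_measure_def g_def)
qed

text \<open>The cut-off of \<open>boosted_measure\<close> is the preimage of the unit ball, so the
  boost carries it to the rotation-invariant measure, up to the constant by which it scales
  \<open>cone_measure\<close>.\<close>

lemma distr_boosted:
  fixes i :: "'m::{finite,wellorder}"
  assumes "t > 0"
  shows "distr (boosted_measure i t) borel (boost i t) =
           density cone_ball_measure (\<lambda>_. ennreal (1 / sqrt (t * (4 + t)) ^ (CARD('m) - 1)))"
proof -
  define g where "g = (\<lambda>x::real^'m::{finite,wellorder}. ennreal (indicat_real (cball 0 1) x))"
  define c where "c = 1 / sqrt (t * (4 + t)) ^ (CARD('m) - 1)"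
  have [measurable]: "g \<in> borel_measurable borel"
    unfolding g_def by (simp add: borel_measurable_indicator)
  have "distr (boosted_measure i t) borel (boost i t) = density (distr cone_measure borel (boost i t)) g"
    by (subst density_distr) (auto simp: boosted_measure_def g_def comp_def)
  also have "\<dots> = density (density cone_measure (\<lambda>_. ennreal c)) g"
    using distr_cone_boost[OF assms, of i] by (simp add: c_def)
  also have "\<dots> = density cone_ball_measure (\<lambda>_. ennreal c)"
    by (simp add: cone_ball_measure_def density_density_eq mult.commute flip: g_def)
  finally show ?thesis by (simp add: c_def)
qed

lemma has_bochner_integral_boosted:
  fixes i :: "'m::{finite,wellorder}" and H :: "real^'m::{finite,wellorder} \<Rightarrow> real"
  assumes "t > 0" and H: "integrable cone_ball_measure H"
  shows "has_bochner_integral (boosted_measure i t) (\<lambda>x. H (boost i t x))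
           (1 / sqrt (t * (4 + t)) ^ (CARD('m) - 1) * integral\<^sup>L cone_ball_measure H)"
proof -
  define c where "c = 1 / sqrt (t * (4 + t)) ^ (CARD('m) - 1)"
  have "c \<ge> 0" using assms by (simp add: c_def)
  have [measurable]: "H \<in> borel_measurable borel"
    using borel_measurable_integrable[OF H] by simp
  have e: "distr (boosted_measure i t) borel (boost i t) = density cone_ball_measure (\<lambda>_. ennreal c)"
    using distr_boosted[OF assms(1), of i] by (simp add: c_def)
  have "integrable (distr (boosted_measure i t) borel (boost i t)) H"
    unfolding e using H \<open>c \<ge> 0\<close> by (subst integrable_real_density) auto
  moreover have "integral\<^sup>L (distr (boosted_measure i t) borel (boost i t)) H = c * integral\<^sup>L cone_ball_measure H"
    unfolding e using \<open>c \<ge> 0\<close> by (subst integral_real_density) auto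
  ultimately show ?thesis
    unfolding has_bochner_integral_iff c_def[symmetric] by (simp add: integrable_distr_eq integral_distr)
qed

section \<open>Size of caps in the cone measure\<close>

lemma emeasure_cone_ball:
  assumes "S \<in> sets borel"
  shows "emeasure cone_ball_measure S = (\<integral>\<^sup>+x. ennreal (indicat_real (cball 0 1 \<inter> S) x / norm x) \<partial>lborel)"
proof -
  have [measurable]: "S \<in> sets borel" by fact
  have ind [measurable]: "(\<lambda>x. ennreal (indicat_real (cball 0 1) (x::'a))) \<in> borel_measurable borel"
    by (simp add: borel_measurable_indicator)
  have "emeasure cone_ball_measure S = (\<integral>\<^sup>+x. ennreal (indicat_real (cball 0 1) x) * indicator S x \<partial>cone_measure)"
    unfolding cone_ball_measure_def by (rule emeasure_density) (simp_all add: cone_measure_def)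
  also have "\<dots> = (\<integral>\<^sup>+x. ennreal (1 / norm x) * (ennreal (indicat_real (cball 0 1) x) * indicator S x) \<partial>lborel)"
    unfolding cone_measure_def by (rule nn_integral_density) auto
  also have "\<dots> = (\<integral>\<^sup>+x. ennreal (indicat_real (cball 0 1 \<inter> S) x / norm x) \<partial>lborel)"
    by (intro nn_integral_cong) (simp add: indicator_def)
  finally show ?thesis .
qed

lemma minkowski_axis: "minkowski (x::real^'n) (axis i 1) = norm x - x $ i"
  by (simp add: minkowski_def inner_axis)

lemma minkowski_nonneg: "minkowski x y \<ge> 0"
  by (simp add: minkowski_def norm_cauchy_schwarz)

lemma measurable_minkowski [measurable]: "(\<lambda>x::'a::euclidean_space. minkowski x y) \<in> borel_measurable borel"
  unfolding minkowski_def by measurable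

lemma emeasure_lborel_slab:
  fixes i :: "'n::finite"
  assumes "a \<ge> 0" "b \<ge> 0"
  shows "emeasure lborel (cbox (- (\<chi> j. if j = i then a else b)) (\<chi> j. if j = i then a else b) :: (real^'n) set)
           = ennreal (2 * a * (2 * b) ^ (CARD('n) - 1))"
proof -
  define u where "u = (\<chi> j. if j = i then a else b :: real^'n)"
  have le: "- u $ j \<le> u $ j" for j using assms by (simp add: u_def)
  then have ne: "cbox (- u) u \<noteq> {}" by (simp add: interval_ne_empty_cart)
  have "measure lborel (cbox (- u) u) = (\<Prod>j\<in>UNIV. u $ j - (- u) $ j)"
    by (rule content_cbox_cart[OF ne])
  also have "\<dots> = (\<Prod>j\<in>UNIV. if j = i then 2 * a else 2 * b)"
    by (intro prod.cong) (auto simp: u_def)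
  also have "\<dots> = 2 * a * (2 * b) ^ (CARD('n) - 1)"
  proof -
    have "(\<Prod>j\<in>UNIV - {i}. if j = i then 2 * a else 2 * b) = (\<Prod>j\<in>UNIV - {i}. 2 * b)"
      by (rule prod.cong) auto
    also have "\<dots> = (2 * b) ^ (CARD('n) - 1)" by (simp add: card_Diff_singleton del: power_mult_distrib)
    finally show ?thesis by (subst prod.remove[of _ i]) auto
  qed
  finally have "measure lborel (cbox (- u) u) = 2 * a * (2 * b) ^ (CARD('n) - 1)" .
  moreover have "emeasure lborel (cbox (- u) u) = ennreal (measure lborel (cbox (- u) u))"
    by (rule emeasure_eq_ennreal_measure) (simp add: emeasure_lborel_cbox_eq)
  ultimately show ?thesis by (simp add: u_def)
qed

text \<open>The sum of the geometric series over dyadic shells; \<open>4 * 2 ^ d\<close> collects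
  the density bound \<open>2 ^ Suc k\<close> and the side lengths of the slabs.\<close>

definition cap_const :: "nat \<Rightarrow> real" where
  "cap_const d = 4 * 2 ^ d / (1 - 2 powr (- real d / 2))"

lemma cap_const_nonneg: "cap_const d \<ge> 0"
proof -
  have "2 powr (- real d / 2) \<le> (1::real)" using powr_mono[of "- real d / 2" 0 2] by simp
  then show ?thesis by (simp add: cap_const_def)
qed

text \<open>Where \<open>norm x\<close> is about \<open>1 / 2 ^ k\<close>, every transverse
  coordinate has square at most \<open>(norm x - x $ i) * (norm x + x $ i) \<le> e / 2 ^ k\<close>.
  The shell thus lies in a thin slab, and slab volumes times the density \<open>1 / norm x\<close>
  sum geometrically.\<close>

lemma emeasure_cone_ball_cap_le:
  fixes i :: "'n::finite"
  assumes "e > 0" "CARD('n) \<ge> 2"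
  shows "emeasure cone_ball_measure {x::real^'n. 2 * minkowski x (axis i 1) \<le> e}
           \<le> ennreal (cap_const (CARD('n) - 1) * e powr (real (CARD('n) - 1) / 2))"
proof -
  define d where "d = CARD('n) - 1"
  have d: "d \<ge> 1" using assms by (simp add: d_def)
  define S where "S = {x::real^'n. 2 * minkowski x (axis i 1) \<le> e}"
  have [measurable]: "S \<in> sets borel" unfolding S_def by measurable
  define u where "u = (\<lambda>k::nat. (\<chi> j. if j = i then 1 / 2 ^ k else sqrt (e / 2 ^ k)) :: real^'n)"
  define Q where "Q = (\<lambda>k. cbox (- u k) (u k))"
  have "emeasure cone_ball_measure S = (\<integral>\<^sup>+x. ennreal (indicat_real (cball 0 1 \<inter> S) x / norm x) \<partial>lborel)"
    by (simp add: emeasure_cone_ball)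
  also have "\<dots> \<le> (\<integral>\<^sup>+x. (\<Sum>k. ennreal (2 ^ Suc k) * indicator (Q k) x) \<partial>lborel)"
  proof (rule nn_integral_mono)
    fix x :: "real^'n"
    show "ennreal (indicat_real (cball 0 1 \<inter> S) x / norm x) \<le> (\<Sum>k. ennreal (2 ^ Suc k) * indicator (Q k) x)"
    proof (cases "x \<in> cball 0 1 \<inter> S \<and> x \<noteq> 0")
      case True
      then have n: "norm x > 0" "norm x \<le> 1" and S: "2 * (norm x - x $ i) \<le> e"
        by (auto simp: S_def minkowski_axis)
      from n obtain k where k: "2 ^ k \<le> 1 / norm x" "1 / norm x < 2 ^ Suc k"
        using dyadic_bracket[of "1 / norm x"] by auto
      have nk: "norm x \<le> 1 / 2 ^ k" using k n by (simp add: field_simps)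
      have "\<bar>x $ j\<bar> \<le> u k $ j" for j
      proof (cases "j = i")
        case True
        then show ?thesis using component_le_norm_cart[of x j] nk by (simp add: u_def)
      next
        case False
        have "x $ j * x $ j \<le> (\<Sum>l\<in>UNIV - {i}. x $ l * x $ l)"
          using False by (intro member_le_sum) auto
        also have "\<dots> = (norm x - x $ i) * (norm x + x $ i)"
          using power2_norm_split[of x i] by (simp add: power2_eq_square algebra_simps)
        also have "\<dots> \<le> (e / 2) * (2 / 2 ^ k)"
          using component_le_norm_cart[of x i] S nk by (intro mult_mono) auto
        finally have "(x $ j)\<^sup>2 \<le> e / 2 ^ k" by (simp add: power2_eq_square)
        then show ?thesis using False real_le_rsqrt[of "\<bar>x $ j\<bar>" "e / 2 ^ k"] by (simp add: u_def)
      qed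
      then have "x \<in> Q k" by (simp add: Q_def mem_box_cart abs_le_iff) (metis minus_le_iff)
      then have "ennreal (indicat_real (cball 0 1 \<inter> S) x / norm x) \<le> ennreal (2 ^ Suc k) * indicator (Q k) x"
        using k True by (simp add: ennreal_leI less_imp_le)
      also have "\<dots> \<le> (\<Sum>k. ennreal (2 ^ Suc k) * indicator (Q k) x)" by (rule le_suminf)
      finally show ?thesis .
    qed auto
  qed
  also have "\<dots> = (\<Sum>k. \<integral>\<^sup>+x. ennreal (2 ^ Suc k) * indicator (Q k) x \<partial>lborel)"
    by (rule nn_integral_suminf) (simp add: Q_def)
  also have "\<dots> = (\<Sum>k. ennreal (4 * 2 ^ d * e powr (real d / 2) * (2 powr (- real d / 2)) ^ k))"
  proof (intro suminf_cong)
    fix k :: nat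
    have "2 ^ Suc k * (2 * (1 / 2 ^ k) * (2 * sqrt (e / 2 ^ k)) ^ d) = 4 * (2 * sqrt (e / 2 ^ k)) ^ d"
      by simp
    also have "\<dots> = 4 * 2 ^ d * e powr (real d / 2) * (2 powr (- real d / 2)) ^ k"
    proof -
      have "sqrt (e / 2 ^ k) ^ d = (e * 2 powr (- real k)) powr (real d / 2)"
        using assms by (simp add: powr_half_sqrt[symmetric] powr_powr powr_minus_divide powr_realpow
            flip: powr_realpow)
      also have "\<dots> = e powr (real d / 2) * (2 powr (- real d / 2)) ^ k"
        using assms by (simp add: powr_mult powr_powr mult.commute flip: powr_realpow)
      finally show ?thesis by (simp add: power_mult_distrib)
    qed
    finally have eq: "2 ^ Suc k * (2 * (1 / 2 ^ k) * (2 * sqrt (e / 2 ^ k)) ^ d) =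
      4 * 2 ^ d * e powr (real d / 2) * (2 powr (- real d / 2)) ^ k" .
    have "(\<integral>\<^sup>+x. ennreal (2 ^ Suc k) * indicator (Q k) x \<partial>lborel) = ennreal (2 ^ Suc k) * emeasure lborel (Q k)"
      by (simp add: nn_integral_cmult_indicator Q_def)
    also have "emeasure lborel (Q k) = ennreal (2 * (1 / 2 ^ k) * (2 * sqrt (e / 2 ^ k)) ^ d)"
      unfolding Q_def u_def d_def by (rule emeasure_lborel_slab) (use assms in auto)
    also have "ennreal (2 ^ Suc k) * \<dots> = ennreal (2 ^ Suc k * (2 * (1 / 2 ^ k) * (2 * sqrt (e / 2 ^ k)) ^ d))"
      using assms by (subst ennreal_mult) auto
    finally show "(\<integral>\<^sup>+x. ennreal (2 ^ Suc k) * indicator (Q k) x \<partial>lborel) =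
        ennreal (4 * 2 ^ d * e powr (real d / 2) * (2 powr (- real d / 2)) ^ k)"
      unfolding eq .
  qed
  also have "\<dots> = ennreal (4 * 2 ^ d * e powr (real d / 2) * (1 / (1 - 2 powr (- real d / 2))))"
  proof (rule suminf_ennreal_eq)
    have "2 powr (- real d / 2) < (1::real)" using d by (simp add: powr_less_one)
    then show "(\<lambda>k. 4 * 2 ^ d * e powr (real d / 2) * (2 powr (- real d / 2)) ^ k) sums
      (4 * 2 ^ d * e powr (real d / 2) * (1 / (1 - 2 powr (- real d / 2))))"
      by (intro sums_mult geometric_sums) auto
  qed simp
  finally show ?thesis by (simp add: S_def cap_const_def d_def mult_ac)
qed

section \<open>Kernel integrals\<close>

text \<open>Equality in Cauchy-Schwarz forces \<open>x\<close> onto the line through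
  \<open>y\<close>, which is negligible in dimension at least 2. The set has to be discarded because
  \<open>kern s 0\<close> is a finite default value and not \<infinity>.\<close>

lemma null_sets_minkowski_eq_0:
  fixes y :: "real^'n"
  assumes "y \<noteq> 0" "CARD('n) \<ge> 2"
  shows "{x. minkowski x y = 0} \<in> null_sets lborel"
proof -
  have "{x. minkowski x y = 0} \<subseteq> span {y}"
  proof
    fix x assume "x \<in> {x. minkowski x y = 0}"
    then have "norm x *\<^sub>R y = norm y *\<^sub>R x"
      using norm_cauchy_schwarz_eq[of x y] by (simp add: minkowski_def)
    then have "x = (norm x / norm y) *\<^sub>R y"
      using assms by (simp add: eq_vector_fraction_iff)
    then show "x \<in> span {y}" by (metis span_base span_scale singletonI)
  qed
  moreover have "negligible (span {y})"
    using dim_le_card[of "span {y}" "{y}"] assms by (intro negligible_lowdim) (simp add: dim_span)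
  ultimately have "{x. minkowski x y = 0} \<in> null_sets lebesgue"
    using negligible_subset negligible_iff_null_sets by blast
  moreover have "{x. minkowski x y = 0} \<in> sets borel" by measurable
  ultimately show ?thesis by (simp add: null_sets_completion_iff)
qed

lemma AE_cone_minkowski_pos:
  fixes y :: "real^'n"
  assumes "y \<noteq> 0" "CARD('n) \<ge> 2"
  shows "AE x in cone_measure. minkowski x y > 0"
proof -
  have "AE x in lborel. minkowski x y > 0"
    using AE_not_in[OF null_sets_minkowski_eq_0[OF assms]]
    by eventually_elim (use minkowski_nonneg[of _ y] in \<open>auto simp: less_le\<close>)
  then show ?thesis unfolding cone_measure_def by (subst AE_density) auto
qed

lemma AE_cone_nonzero: "AE x in cone_measure. x \<noteq> 0"
  unfolding cone_measure_def by (subst AE_density) auto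

lemma AE_cone_ball_I:
  assumes "AE x in cone_measure. P x"
  shows "AE x in cone_ball_measure. norm x > 0 \<and> norm x \<le> 1 \<and> P x"
proof -
  have "AE x in cone_measure. ennreal (indicat_real (cball 0 1) x) > 0 \<longrightarrow> norm x > 0 \<and> norm x \<le> 1 \<and> P x"
    using assms AE_cone_nonzero by eventually_elim (auto simp: indicator_def)
  then show ?thesis unfolding cone_ball_measure_def by (subst AE_density) (auto simp: cone_measure_def)
qed

lemma AE_boosted_I:
  assumes "AE x in cone_measure. P x"
  shows "AE x in boosted_measure i t. norm x > 0 \<and> norm (boost i t x) \<le> 1 \<and> P x"
proof -
  have "AE x in cone_measure. ennreal (indicat_real (cball 0 1) (boost i t x)) > 0 \<longrightarrow>
      norm x > 0 \<and> norm (boost i t x) \<le> 1 \<and> P x"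
    using assms AE_cone_nonzero by eventually_elim (auto simp: indicator_def)
  then show ?thesis unfolding boosted_measure_def by (subst AE_density) (auto simp: cone_measure_def)
qed

lemma minkowski_axis_le: "2 * minkowski x (axis i 1) \<le> 4 * norm (x::real^'n)"
  using component_le_norm_cart[of x i] by (simp add: minkowski_axis)

lemma finite_measure_cone_ball:
  fixes i :: "'n::finite"
  assumes "CARD('n) \<ge> 2"
  shows "finite_measure (cone_ball_measure :: (real^'n) measure)"
proof
  \<comment> \<open>Up to null sets the whole unit ball is the cap of level 4, the largest squared
    distance on the sphere.\<close>
  have "emeasure (cone_ball_measure :: (real^'n) measure) (space cone_ball_measure) = emeasure cone_ball_measure {x::real^'n. 2 * minkowski x (axis i 1) \<le> 4}"
  proof (rule emeasure_eq_AE)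
    have "AE x::real^'n in cone_ball_measure. norm x > 0 \<and> norm x \<le> 1 \<and> True" by (rule AE_cone_ball_I) simp
    then show "AE x::real^'n in cone_ball_measure. (x \<in> space cone_ball_measure) = (x \<in> {x. 2 * minkowski x (axis i 1) \<le> 4})"
    proof eventually_elim
      case (elim x)
      then show ?case using minkowski_axis_le[of x i] by simp
    qed
  qed simp_all
  also have "\<dots> < \<infinity>"
    using emeasure_cone_ball_cap_le[of 4 i] assms by (auto simp: less_top intro: le_less_trans)
  finally show "emeasure (cone_ball_measure :: (real^'n) measure) (space cone_ball_measure) \<noteq> \<infinity>" by simp
qed

lemma measure_cone_ball_pos:
  fixes i :: "'n::finite"
  assumes "CARD('n) \<ge> 2"
  shows "measure (cone_ball_measure :: (real^'n) measure) UNIV > 0"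
proof -
  interpret finite_measure "cone_ball_measure :: (real^'n) measure" by (rule finite_measure_cone_ball[OF assms])
  have "0 < emeasure lborel (cball (0::real^'n) 1)" by (simp add: emeasure_cball unit_ball_vol_pos)
  also have "\<dots> = (\<integral>\<^sup>+x. indicator (cball (0::real^'n) 1) x \<partial>lborel)" by simp
  also have "\<dots> \<le> (\<integral>\<^sup>+x. ennreal (indicat_real (cball 0 1 \<inter> UNIV) (x::real^'n) / norm x) \<partial>lborel)"
  proof (rule nn_integral_mono_AE)
    have "AE x in lborel. x \<noteq> (0::real^'n)" by (rule AE_lborel_singleton)
    then show "AE x::real^'n in lborel. indicator (cball 0 1) x \<le> ennreal (indicat_real (cball 0 1 \<inter> UNIV) x / norm x)"
      by eventually_elim (auto simp: indicator_def field_simps simp flip: ennreal_1 intro!: ennreal_leI)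
  qed
  also have "\<dots> = emeasure (cone_ball_measure :: (real^'n) measure) UNIV" by (subst emeasure_cone_ball) auto
  finally show ?thesis by (simp add: emeasure_eq_measure)
qed

lemma integrable_cone_ball_minkowski_powr:
  fixes i :: "'n::finite"
  assumes "CARD('n) \<ge> 2" "0 \<le> p" "p < real (CARD('n) - 1) / 2"
  shows "integrable cone_ball_measure (\<lambda>x::real^'n. (2 * minkowski x (axis i 1)) powr (- p))"
proof (rule integrableI_nonneg)
  let ?w = "\<lambda>x::real^'n. 2 * minkowski x (axis i 1)"
  have "AE x::real^'n in cone_ball_measure. norm x > 0 \<and> norm x \<le> 1 \<and> True" by (rule AE_cone_ball_I) simp
  then have "AE x in cone_ball_measure. ennreal (?w x powr (- p)) = ennreal (if 0 < ?w x \<and> ?w x \<le> 4 then ?w x powr (- p) else 0)"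
  proof eventually_elim
    case (elim x)
    then show ?case using minkowski_axis_le[of x i] minkowski_nonneg[of x "axis i 1"] by (auto simp: less_le)
  qed
  then have "(\<integral>\<^sup>+x. ennreal (?w x powr (- p)) \<partial>cone_ball_measure) =
      (\<integral>\<^sup>+x. ennreal (if 0 < ?w x \<and> ?w x \<le> 4 then ?w x powr (- p) else 0) \<partial>cone_ball_measure)"
    by (rule nn_integral_cong_AE)
  also have "\<dots> \<le> ennreal (2 powr p * cap_const (CARD('n) - 1) * 4 powr (real (CARD('n) - 1) / 2 - p)
      / (1 - 2 powr (p - real (CARD('n) - 1) / 2)))"
    by (rule nn_integral_powr_sublevel_le)
      (use emeasure_cone_ball_cap_le[of _ i] cap_const_nonneg assms in auto)
  also have "\<dots> < \<infinity>" by simp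
  finally show "(\<integral>\<^sup>+x. ennreal (?w x powr (- p)) \<partial>cone_ball_measure) < \<infinity>" .
qed auto

text \<open>These are the normalisation constants. With \<open>M\<close> the total mass of
  \<open>cone_ball_measure\<close>, the smoothed density at scale \<open>t\<close> has mass
  proportional to \<open>M + s * kern_int i s t\<close>, and \<open>kern_int i s 0\<close> is the
  potential of \<open>cone_ball_measure\<close> at a unit vector.\<close>

definition kern_int :: "'n::finite \<Rightarrow> real \<Rightarrow> real \<Rightarrow> real" where
  "kern_int i s t = (LINT x::real^'n|cone_ball_measure. kern s (2 * minkowski x (axis i 1) + t * norm x))"

lemma measurable_kern [measurable]: "kern s \<in> borel_measurable borel"
  unfolding kern_def by measurable

lemma has_bochner_integral_kern_int:
  fixes i :: "'n::finite"
  assumes "CARD('n) \<ge> 2" "0 \<le> s" "s < real (CARD('n) - 1)" "t \<ge> 0"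
  shows "has_bochner_integral cone_ball_measure (\<lambda>x::real^'n. kern s (2 * minkowski x (axis i 1) + t * norm x)) (kern_int i s t)"
proof -
  let ?w = "\<lambda>x::real^'n. 2 * minkowski x (axis i 1)"
  \<comment> \<open>Half of the available room \<open>(d - s) / 2\<close> between
    \<open>s / 2\<close> and the critical exponent \<open>d / 2\<close>, where
    \<open>d = CARD('n) - 1\<close>.\<close>
  define h where "h = min 1 ((real (CARD('n) - 1) - s) / 4)"
  have h: "0 < h" "h \<le> 1" "s / 2 + h < real (CARD('n) - 1) / 2"
  proof -
    have "s / 2 + (a - s) / 4 < a / 2" if "s < a" for a :: real using that by (simp add: field_simps)
    from this[OF assms(3)] show "s / 2 + h < real (CARD('n) - 1) / 2" by (simp add: h_def min_def)
  qed (use assms in \<open>auto simp: h_def\<close>)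
  interpret finite_measure "cone_ball_measure :: (real^'n) measure" by (rule finite_measure_cone_ball[OF assms(1)])
  have "integrable cone_ball_measure (\<lambda>x::real^'n. kern s (?w x + t * norm x))"
  proof (rule Bochner_Integration.integrable_bound)
    show "integrable cone_ball_measure (\<lambda>x. \<bar>kern s (4 + t)\<bar> + \<bar>kern s 4\<bar> + 4 powr h / h * ?w x powr (- (s / 2 + h)))"
      using integrable_cone_ball_minkowski_powr[of "s / 2 + h" i] assms h by simp
    have "AE x in cone_ball_measure. norm x > 0 \<and> norm x \<le> 1 \<and> minkowski x (axis i (1::real)) > 0"
      using assms by (intro AE_cone_ball_I AE_cone_minkowski_pos) auto
    then show "AE x in cone_ball_measure. norm (kern s (?w x + t * norm x)) \<le>
        norm (\<bar>kern s (4 + t)\<bar> + \<bar>kern s 4\<bar> + 4 powr h / h * ?w x powr (- (s / 2 + h)))"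
    proof eventually_elim
      case (elim x)
      have w: "0 < ?w x" "?w x \<le> 4" using elim minkowski_axis_le[of x i] by auto
      have tx: "t * norm x \<le> t" "0 \<le> t * norm x" using elim assms by (auto simp: mult_left_le)
      have "kern s (4 + t) \<le> kern s (?w x + t * norm x)" using w tx by (intro kern_antimono) auto
      moreover have "kern s (?w x + t * norm x) \<le> kern s (?w x)" using w tx by (intro kern_antimono) auto
      moreover have "kern s (?w x) - kern s (?w x + 4) \<le> 4 powr h / h * ?w x powr (- s / 2 - h)"
        using w h assms by (intro kern_diff_le_powr) auto
      moreover have "kern s (?w x + 4) \<le> kern s 4" using w by (intro kern_antimono) auto
      moreover have "- s / 2 - h = - (s / 2 + h)" by simp
      moreover have "4 powr h / h * ?w x powr (- (s / 2 + h)) \<ge> 0" using h by simp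
      ultimately show ?case by simp
    qed
  qed measurable
  then show ?thesis by (simp add: has_bochner_integral_iff kern_int_def)
qed

section \<open>Orthogonal invariance and averages of the kernel\<close>

lemma has_bochner_integral_cone_ball_orthogonal:
  fixes f :: "real^'m::{finite,wellorder} \<Rightarrow> real^'m::{finite,wellorder}" and H :: "_ \<Rightarrow> real"
  assumes f: "orthogonal_transformation f" and H: "has_bochner_integral cone_ball_measure H b"
  shows "has_bochner_integral cone_ball_measure (\<lambda>x. H (f x)) b"
proof -
  have [measurable]: "f \<in> borel_measurable borel"
    using f orthogonal_transformation_linear linear_continuous_on linear_conv_bounded_linear
      borel_measurable_continuous_onI by blast
  have [measurable]: "H \<in> borel_measurable borel"
    using borel_measurable_has_bochner_integral[OF H] by simp
  have "has_bochner_integral (distr cone_ball_measure borel f) H b" using H distr_cone_ball_orthogonal[OF f] by simp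
  then show ?thesis unfolding has_bochner_integral_iff by (simp add: integrable_distr_eq integral_distr)
qed

lemma minkowski_orthogonal: "orthogonal_transformation f \<Longrightarrow> minkowski (f x) (f y) = minkowski x y"
  by (simp add: minkowski_def orthogonal_transformation_norm orthogonal_transformation_def)

lemma minkowski_scale: "c \<ge> 0 \<Longrightarrow> minkowski x (c *\<^sub>R y) = c * minkowski x y"
  by (simp add: minkowski_def algebra_simps)

lemma kern_int_unit:
  fixes i :: "'m::{finite,wellorder}"
  assumes "CARD('m) \<ge> 2" "0 \<le> s" "s < real (CARD('m) - 1)" "t \<ge> 0" "norm u = 1"
  shows "has_bochner_integral cone_ball_measure (\<lambda>x::real^'m::{finite,wellorder}. kern s (2 * minkowski x u + t * norm x)) (kern_int i s t)"
proof -
  obtain f where f: "orthogonal_transformation f" "f u = axis i (1::real)"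
    using orthogonal_transformation_exists[of u "axis i 1"] assms by auto
  show ?thesis
    using has_bochner_integral_cone_ball_orthogonal[OF f(1) has_bochner_integral_kern_int[of s t i]] assms
    by (simp add: minkowski_orthogonal[OF f(1)] orthogonal_transformation_norm[OF f(1)] flip: f(2))
qed

text \<open>By rotation invariance only \<open>norm v\<close> matters, and the scaling law makes the
  potential affine in \<open>kern s (norm v)\<close>. The coefficient
  \<open>s * kern_int i s 0\<close> comes from rewriting \<open>norm v powr (- s / 2)\<close> as
  \<open>1 + s * kern s (norm v)\<close>.\<close>

lemma has_bochner_integral_cone_ball_kern:
  fixes i :: "'m::{finite,wellorder}"
  assumes "CARD('m) \<ge> 2" "0 \<le> s" "s < real (CARD('m) - 1)" "v \<noteq> 0"
  shows "has_bochner_integral cone_ball_measure (\<lambda>x::real^'m::{finite,wellorder}. kern s (2 * minkowski x v))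
    ((measure (cone_ball_measure :: (real^'m::{finite,wellorder}) measure) UNIV + s * kern_int i s 0) * kern s (norm v) + kern_int i s 0)"
proof -
  let ?M = "measure (cone_ball_measure :: (real^'m::{finite,wellorder}) measure) UNIV"
  interpret finite_measure "cone_ball_measure :: (real^'m::{finite,wellorder}) measure" by (rule finite_measure_cone_ball[OF assms(1)])
  define u where "u = v /\<^sub>R norm v"
  have u: "norm u = 1" "v = norm v *\<^sub>R u" using assms by (auto simp: u_def)
  have "has_bochner_integral cone_ball_measure (\<lambda>x. norm v powr (- s / 2) * kern s (2 * minkowski x u) + kern s (norm v))
      (norm v powr (- s / 2) * kern_int i s 0 + ?M * kern s (norm v))"
    using kern_int_unit[of s 0 u i] assms u
    by (intro has_bochner_integral_add has_bochner_integral_mult_right)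
      (auto simp: has_bochner_integral_iff)
  also have "norm v powr (- s / 2) = 1 + s * kern s (norm v)"
    using assms by (intro powr_eq_kern) auto
  also have "(1 + s * kern s (norm v)) * kern_int i s 0 + ?M * kern s (norm v) =
      (?M + s * kern_int i s 0) * kern s (norm v) + kern_int i s 0" by (simp add: algebra_simps)
  finally have *: "has_bochner_integral cone_ball_measure (\<lambda>x. (1 + s * kern s (norm v)) * kern s (2 * minkowski x u) + kern s (norm v))
      ((?M + s * kern_int i s 0) * kern s (norm v) + kern_int i s 0)" .
  have "AE x in cone_ball_measure. norm x > 0 \<and> norm x \<le> 1 \<and> minkowski x u > 0"
    using assms u by (intro AE_cone_ball_I AE_cone_minkowski_pos) auto
  then have AE: "AE x in cone_ball_measure. (1 + s * kern s (norm v)) * kern s (2 * minkowski x u) + kern s (norm v) = kern s (2 * minkowski x v)"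
  proof eventually_elim
    case (elim x)
    have "kern s (norm v * (2 * minkowski x u)) = norm v powr (- s / 2) * kern s (2 * minkowski x u) + kern s (norm v)"
      using elim assms by (intro kern_mult) auto
    moreover have "norm v * (2 * minkowski x u) = 2 * minkowski x v" using minkowski_scale[of "norm v" x u] u by simp
    moreover have "norm v powr (- s / 2) = 1 + s * kern s (norm v)" using assms by (intro powr_eq_kern) auto
    ultimately show ?case by simp
  qed
  show ?thesis by (rule has_bochner_integral_cong_AE[THEN iffD1, OF _ _ AE *]) measurable
qed

text \<open>The argument is \<open>t * (4 + t)\<close> times the norm of the unboosted vector, so
  this integral appears when the weight \<open>norm x powr (- s / 2)\<close> is transported to the
  unit ball. The reflection of \<open>x\<close> identifies it with \<open>kern_int\<close>.\<close>

lemma kern_int_reflect: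
  fixes i :: "'m::{finite,wellorder}"
  assumes "CARD('m) \<ge> 2" "0 \<le> s" "s < real (CARD('m) - 1)" "t \<ge> 0"
  shows "has_bochner_integral cone_ball_measure (\<lambda>x::real^'m::{finite,wellorder}. kern s ((2 + t) * norm x + 2 * x $ i)) (kern_int i s t)"
proof -
  have f: "orthogonal_transformation (uminus :: real^'m::{finite,wellorder} \<Rightarrow> _)"
    by (simp add: orthogonal_transformation_def linear_uminus)
  have e: "2 * minkowski (- x) (axis i 1) + t * norm (- x) = (2 + t) * norm x + 2 * x $ i" for x :: "real^'m::{finite,wellorder}"
    by (simp add: minkowski_axis algebra_simps)
  show ?thesis
    using has_bochner_integral_cone_ball_orthogonal[OF f has_bochner_integral_kern_int[of s t i]] assms
    unfolding e by simp
qed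

lemma unboost_norm:
  assumes "t > 0"
  shows "(2 + t) * norm (boost i t x) + 2 * boost i t x $ i = t * (4 + t) * norm x"
proof -
  have "norm x = ((2 + t) * norm (boost i t x) + 2 * boost i t x $ i) / (t * (4 + t))"
    using norm_unboost[OF assms, of i "boost i t x"] unboost_boost(1)[OF assms, of i x] by simp
  moreover have "t * (4 + t) \<noteq> 0" using assms by simp
  ultimately show ?thesis by (metis nonzero_mult_div_cancel_left times_divide_eq_right)
qed

lemma boost_factor:
  fixes n :: nat and D :: real
  assumes "D > 0"
  shows "1 / sqrt D ^ n * D powr (s / 2) = D powr ((s - real n) / 2)"
proof -
  have "sqrt D ^ n = D powr (real n / 2)"
    using assms by (simp add: powr_half_sqrt[symmetric] powr_powr flip: powr_realpow)
  then have "1 / sqrt D ^ n * D powr (s / 2) = D powr (s / 2 - real n / 2)"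
    using assms by (simp add: powr_diff)
  then show ?thesis by (simp add: diff_divide_distrib)
qed

text \<open>
  Averaging the kernel over \<open>boosted_measure i t\<close> regularises it: up to constants independent of
  \<open>y\<close>, the value at \<open>\<bar>y - e\<bar>\<^sup>2\<close> is replaced by the value at \<open>\<bar>y - e\<bar>\<^sup>2 + t\<close>.
\<close>

lemma boosted_kern:
  fixes i :: "'m::{finite,wellorder}" and y :: "real^'m::{finite,wellorder}"
  assumes "CARD('m) \<ge> 2" "0 \<le> s" "s < real (CARD('m) - 1)" "t > 0" "norm y = 1"
  defines "M \<equiv> measure (cone_ball_measure :: (real^'m::{finite,wellorder}) measure) UNIV"
  shows "has_bochner_integral (boosted_measure i t) (\<lambda>x. norm x powr (- s / 2) * kern s (2 * minkowski x y / norm x))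
    ((t * (4 + t)) powr ((s - real (CARD('m) - 1)) / 2) *
      ((M + s * kern_int i s 0) * kern s (2 + t - 2 * y $ i) + kern_int i s 0 - kern_int i s t))"
proof -
  define D where "D = t * (4 + t)"
  have D: "D > 0" using assms by (simp add: D_def)
  \<comment> \<open>The weighted kernel equals
    \<open>kern s (2 * minkowski x y) - kern s (norm x)\<close>. In boosted coordinates both terms
    acquire the same \<open>kern s D\<close>, which cancels.\<close>
  define H where "H = (\<lambda>z::real^'m::{finite,wellorder}. D powr (s / 2) *
    (kern s (2 * minkowski z (boost i t y)) - kern s ((2 + t) * norm z + 2 * z $ i)))"
  define V where "V = D powr (s / 2) *
    (((M + s * kern_int i s 0) * kern s (2 + t - 2 * y $ i) + kern_int i s 0) - kern_int i s t)"
  \<comment> \<open>This norm is \<open>(norm (y - axis i 1))\<^sup>2 + t\<close>: the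
    rotation-invariant potential at the boosted point is the regularised kernel.\<close>
  have nb: "norm (boost i t y) = 2 + t - 2 * y $ i" using assms norm_boost[of t i y] by simp
  have "2 + t - 2 * y $ i > 0" using component_le_norm_cart[of y i] assms by simp
  then have "boost i t y \<noteq> 0" using nb by auto
  then have H: "has_bochner_integral cone_ball_measure H V"
    unfolding H_def V_def using has_bochner_integral_cone_ball_kern[of s "boost i t y" i] kern_int_reflect[of s t i] assms nb
    by (intro has_bochner_integral_mult_right has_bochner_integral_diff) auto
  then have *: "has_bochner_integral (boosted_measure i t) (\<lambda>x. H (boost i t x)) (1 / sqrt D ^ (CARD('m) - 1) * V)"
    using has_bochner_integral_boosted[OF assms(4), of H i] by (simp add: has_bochner_integral_iff D_def)
  have [measurable]: "H \<in> borel_measurable borel" unfolding H_def by measurable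
  have "AE x in boosted_measure i t. norm x > 0 \<and> norm (boost i t x) \<le> 1 \<and> minkowski x y > 0"
    using assms by (intro AE_boosted_I AE_cone_minkowski_pos) auto
  then have AE: "AE x in boosted_measure i t. H (boost i t x) = norm x powr (- s / 2) * kern s (2 * minkowski x y / norm x)"
  proof eventually_elim
    case (elim x)
    have "kern s (2 * minkowski (boost i t x) (boost i t y)) = D powr (- s / 2) * kern s (2 * minkowski x y) + kern s D"
      using kern_mult[of D "2 * minkowski x y" s] elim D assms minkowski_boost[of t i x y] by (simp add: D_def mult_ac)
    moreover have "kern s ((2 + t) * norm (boost i t x) + 2 * boost i t x $ i) =
        D powr (- s / 2) * kern s (norm x) + kern s D"
      using kern_mult[of D "norm x" s] elim D unboost_norm[OF assms(4), of i x] by (simp add: D_def)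
    ultimately have "H (boost i t x) = D powr (s / 2) * D powr (- s / 2) * (kern s (2 * minkowski x y) - kern s (norm x))"
      unfolding H_def by (simp add: right_diff_distrib)
    also have "D powr (s / 2) * D powr (- s / 2) = 1" using D by (simp flip: powr_add)
    finally show ?case using kern_divide[of "norm x" "2 * minkowski x y" s] elim by simp
  qed
  have "1 / sqrt D ^ (CARD('m) - 1) * V = D powr ((s - real (CARD('m) - 1)) / 2) *
      ((M + s * kern_int i s 0) * kern s (2 + t - 2 * y $ i) + kern_int i s 0 - kern_int i s t)"
    unfolding V_def mult.assoc[symmetric] boost_factor[OF D] by simp
  moreover have "has_bochner_integral (boosted_measure i t)
      (\<lambda>x. norm x powr (- s / 2) * kern s (2 * minkowski x y / norm x)) (1 / sqrt D ^ (CARD('m) - 1) * V)"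
    by (rule has_bochner_integral_cong_AE[THEN iffD1, OF _ _ AE *]) measurable
  ultimately show ?thesis by (simp add: D_def)
qed

text \<open>The transport used for the kernel, applied to the weight alone. It provides the mass
  against which a constant lower bound for the potential is integrated.\<close>

lemma boosted_one:
  fixes i :: "'m::{finite,wellorder}"
  assumes "CARD('m) \<ge> 2" "0 \<le> s" "s < real (CARD('m) - 1)" "t > 0"
  defines "M \<equiv> measure (cone_ball_measure :: (real^'m::{finite,wellorder}) measure) UNIV"
  shows "has_bochner_integral (boosted_measure i t) (\<lambda>x. norm x powr (- s / 2))
    ((t * (4 + t)) powr ((s - real (CARD('m) - 1)) / 2) * (M + s * kern_int i s t))"
proof -
  interpret finite_measure "cone_ball_measure :: (real^'m::{finite,wellorder}) measure" by (rule finite_measure_cone_ball[OF assms(1)])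
  define D where "D = t * (4 + t)"
  have D: "D > 0" using assms by (simp add: D_def)
  define H where "H = (\<lambda>z::real^'m::{finite,wellorder}. D powr (s / 2) *
    (1 + s * kern s ((2 + t) * norm z + 2 * z $ i)))"
  define V where "V = D powr (s / 2) * (M + s * kern_int i s t)"
  have H: "has_bochner_integral cone_ball_measure H V"
    unfolding H_def V_def using kern_int_reflect[of s t i] assms
    by (intro has_bochner_integral_mult_right has_bochner_integral_add)
      (auto simp: has_bochner_integral_iff M_def)
  then have *: "has_bochner_integral (boosted_measure i t) (\<lambda>x. H (boost i t x)) (1 / sqrt D ^ (CARD('m) - 1) * V)"
    using has_bochner_integral_boosted[OF assms(4), of H i] by (simp add: has_bochner_integral_iff D_def)
  have [measurable]: "H \<in> borel_measurable borel" unfolding H_def by measurable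
  have "AE x in boosted_measure i t. norm x > 0 \<and> norm (boost i t x) \<le> 1 \<and> True"
    by (intro AE_boosted_I) auto
  then have AE: "AE x in boosted_measure i t. H (boost i t x) = norm x powr (- s / 2)"
  proof eventually_elim
    case (elim x)
    have "1 + s * kern s ((2 + t) * norm (boost i t x) + 2 * boost i t x $ i) = (D * norm x) powr (- s / 2)"
      unfolding unboost_norm[OF assms(4)] D_def[symmetric] using elim D by (intro powr_eq_kern[symmetric]) simp
    also have "\<dots> = D powr (- s / 2) * norm x powr (- s / 2)" using D by (simp add: powr_mult)
    finally have "H (boost i t x) = D powr (s / 2) * D powr (- s / 2) * norm x powr (- s / 2)"
      unfolding H_def by simp
    also have "D powr (s / 2) * D powr (- s / 2) = 1" using D by (simp flip: powr_add)
    finally show ?case by simp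
  qed
  have "1 / sqrt D ^ (CARD('m) - 1) * V = D powr ((s - real (CARD('m) - 1)) / 2) * (M + s * kern_int i s t)"
    unfolding V_def mult.assoc[symmetric] boost_factor[OF D] by simp
  moreover have "has_bochner_integral (boosted_measure i t) (\<lambda>x. norm x powr (- s / 2)) (1 / sqrt D ^ (CARD('m) - 1) * V)"
    by (rule has_bochner_integral_cong_AE[THEN iffD1, OF _ _ AE *]) measurable
  ultimately show ?thesis by (simp add: D_def)
qed

text \<open>
  The quotient of the scaling factors \<open>t (4 + t)\<close> at \<open>t\<close> and \<open>2 t\<close>. It is the largest weight for which
  the difference of the two boosted averages is still positive when \<open>s = d - 2\<close>, and it is close enough
  to \<open>1/2\<close> to cancel the term of first order in \<open>t\<close>.
\<close>

definition theta :: "real \<Rightarrow> real" where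
  "theta t = (4 + t) / (8 + 4 * t)"

lemma theta_bounds:
  assumes "0 < t"
  shows "0 < theta t" "theta t \<le> 1 / 2" "1 - 2 * theta t \<le> t / 4"
proof -
  show "0 < theta t" "theta t \<le> 1 / 2" using assms by (auto simp: theta_def field_simps)
  have "1 - 2 * theta t = t / (4 + 2 * t)" using assms by (simp add: theta_def field_simps)
  also have "\<dots> \<le> t / 4" using assms by (intro divide_left_mono) auto
  finally show "1 - 2 * theta t \<le> t / 4" .
qed

text \<open>Convexity: both first differences are compared with the derivative at
  \<open>w + t\<close>, and \<open>th \<le> 1 - th\<close> takes care of the weights.\<close>

lemma kern_theta_le:
  assumes "s \<ge> 0" "w > 0" "t > 0" "th \<le> 1 / 2"
  shows "kern s (w + t) - th * kern s (w + 2 * t) \<le> (1 - th) * kern s w"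
proof -
  have "t / 2 * (w + t) powr (- s / 2 - 1) \<le> kern s w - kern s (w + t)"
    using assms by (intro kern_diff_bounds) auto
  moreover have "kern s (w + t) - kern s ((w + t) + t) \<le> t / 2 * (w + t) powr (- s / 2 - 1)"
    using assms by (intro kern_diff_bounds) auto
  ultimately have a: "kern s (w + t) - kern s (w + 2 * t) \<le> kern s w - kern s (w + t)" by (simp add: add.assoc)
  have "kern s (w + 2 * t) \<le> kern s (w + t)" using assms by (intro kern_antimono) auto
  then have "th * (kern s (w + t) - kern s (w + 2 * t)) \<le> (1 - th) * (kern s w - kern s (w + t))"
    using a assms by (intro order_trans[OF mult_right_mono[of th "1 - th"] mult_left_mono]) auto
  then show ?thesis by (simp add: algebra_simps)
qed

text \<open>The left side is \<open>1 - 2 * theta t\<close> times a first difference plus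
  \<open>theta t\<close> times a second difference. Far from the pole both are of second order in
  \<open>t\<close>, the former thanks to \<open>1 - 2 * theta t \<le> t / 4\<close>; near the pole
  one first difference dominates everything.\<close>

lemma defect_pointwise:
  assumes s: "s \<ge> 0" and w: "0 < w" "w \<le> 4" and r: "0 < r" "r \<le> 1" and t: "0 < t" and h: "0 < h" "h \<le> 1"
  shows "(1 - theta t) * kern s w - kern s (w + t * r) + theta t * kern s (w + 2 * t * r)
      \<le> (if w \<le> t then t powr h / h * w powr (- (s / 2 + h)) else (s / 2 + 2) * t\<^sup>2 * w powr (- (s / 2 + 2)))"
proof -
  define x where "x = t * r"
  have x: "0 < x" "x \<le> t" using r t by (auto simp: x_def mult_left_le)
  define a1 where "a1 = kern s w - kern s (w + x)"
  define a2 where "a2 = kern s (w + x) - kern s (w + 2 * x)"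
  note th = theta_bounds[OF t]
  have a: "a1 \<ge> 0" "a2 \<ge> 0" unfolding a1_def a2_def using w x by (auto intro!: kern_antimono)
  have eq: "(1 - theta t) * kern s w - kern s (w + t * r) + theta t * kern s (w + 2 * t * r)
      = (1 - 2 * theta t) * a1 + theta t * (a1 - a2)"
    unfolding a1_def a2_def x_def by (simp add: algebra_simps)
  show ?thesis
  proof (cases "w \<le> t")
    case True
    have "theta t * (a1 - a2) \<le> theta t * a1" using th a by (intro mult_left_mono) auto
    then have "(1 - 2 * theta t) * a1 + theta t * (a1 - a2) \<le> (1 - theta t) * a1"
      by (simp add: algebra_simps)
    also have "\<dots> \<le> 1 * a1" using th a by (intro mult_right_mono) auto
    also have "1 * a1 \<le> kern s w - kern s (w + t)"
      unfolding a1_def using w x by (auto intro!: kern_antimono)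
    also have "\<dots> \<le> t powr h / h * w powr (- s / 2 - h)"
      using s w t h by (intro kern_diff_le_powr) auto
    also have "- s / 2 - h = - (s / 2 + h)" by simp
    finally show ?thesis using True unfolding eq by simp
  next
    case False
    define W where "W = w powr (- s / 2 - 2)"
    have W: "W \<ge> 0" by (simp add: W_def)
    have xt: "x\<^sup>2 \<le> t\<^sup>2" using x by (intro power_mono) auto
    have "1 + (- s / 2 - 2) = - s / 2 - 1" by simp
    then have "w powr (- s / 2 - 1) = w * W"
      using powr_mult_base[of w "- s / 2 - 2"] w by (simp only: W_def)
    \<comment> \<open>Boundedness of \<open>w\<close> trades one power of \<open>w\<close>, so the
      first-order term fits under the majorant of the second-order one.\<close>
    also have "\<dots> \<le> 4 * W" using w W by (intro mult_right_mono) auto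
    finally have ww: "w powr (- s / 2 - 1) \<le> 4 * W" .
    have "a1 \<le> x / 2 * w powr (- s / 2 - 1)"
      unfolding a1_def using s w x by (intro kern_diff_bounds) auto
    also have "\<dots> \<le> t / 2 * (4 * W)" using x ww W by (intro mult_mono) auto
    finally have "a1 \<le> 2 * t * W" by (simp add: mult_ac)
    then have "(1 - 2 * theta t) * a1 \<le> (t / 4) * (2 * t * W)"
      using th a t by (intro mult_mono) auto
    moreover have "a1 - a2 \<le> (s / 2 + 1) * x\<^sup>2 * W"
      unfolding a1_def a2_def W_def using s w x by (intro kern_second_diff) auto
    then have "a1 - a2 \<le> (s / 2 + 1) * t\<^sup>2 * W"
      using xt s W by (elim order_trans) (intro mult_right_mono mult_left_mono, auto)
    then have "theta t * (a1 - a2) \<le> theta t * ((s / 2 + 1) * t\<^sup>2 * W)"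
      using th by (intro mult_left_mono) auto
    moreover have "theta t * ((s / 2 + 1) * t\<^sup>2 * W) \<le> 1 * ((s / 2 + 1) * t\<^sup>2 * W)"
      using th s W by (intro mult_right_mono) auto
    moreover have "(t / 4) * (2 * t * W) \<le> t\<^sup>2 * W" using W by (simp add: power2_eq_square)
    ultimately have "(1 - 2 * theta t) * a1 + theta t * (a1 - a2) \<le> (s / 2 + 2) * t\<^sup>2 * W"
      by (simp add: algebra_simps)
    moreover have "- s / 2 - 2 = - (s / 2 + 2)" by simp
    ultimately show ?thesis using False unfolding eq W_def by simp
  qed
qed

lemma integral_le_of_nn_integral_le:
  assumes "integrable M f" "(\<integral>\<^sup>+x. ennreal (f x) \<partial>M) \<le> ennreal K" "K \<ge> 0"
  shows "integral\<^sup>L M f \<le> K"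
proof -
  have "integral\<^sup>L M f \<le> enn2real (\<integral>\<^sup>+x. ennreal (f x) \<partial>M)"
    using real_lebesgue_integral_def[OF assms(1)] by simp
  also have "\<dots> \<le> K"
    using enn2real_mono[OF assms(2)] assms(3) by simp
  finally show ?thesis .
qed

text \<open>Caps have size \<open>e powr (d / 2)\<close>. Hence the exponent
  \<open>s / 2 + h\<close> is integrable near the pole, \<open>s / 2 + 2\<close> is dominated by its
  cut-off at \<open>t\<close>, and both regimes give \<open>t powr ((d - s) / 2)\<close>,
  independently of the choice of \<open>h\<close>.\<close>

lemma kern_int_defect:
  fixes i :: "'n::finite"
  assumes "CARD('n) \<ge> 2" "0 \<le> s" "real (CARD('n) - 1) - 2 \<le> s" "s < real (CARD('n) - 1)"
  obtains C where "C \<ge> 0" "\<And>t. 0 < t \<Longrightarrow>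
    (1 - theta t) * kern_int i s 0 - kern_int i s t + theta t * kern_int i s (2 * t)
      \<le> C * t powr ((real (CARD('n) - 1) - s) / 2)"
proof -
  define a where "a = real (CARD('n) - 1) / 2"
  define h where "h = min 1 ((a - s / 2) / 2)"
  have h: "0 < h" "h \<le> 1" "s / 2 + h < a"
  proof -
    show "s / 2 + h < a" using assms by (auto simp: h_def a_def min_def field_simps)
  qed (use assms in \<open>auto simp: h_def a_def\<close>)
  define K where "K = cap_const (CARD('n) - 1)"
  define A where "A = 2 powr (s / 2 + h) * K / (1 - 2 powr ((s / 2 + h) - a))"
  define B where "B = 2 powr a * K / (1 - 2 powr (a - (s / 2 + 2)))"
  have K: "K \<ge> 0" by (simp add: K_def cap_const_nonneg)
  have p2: "a < s / 2 + 2" using assms by (simp add: a_def)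
  have "2 powr ((s / 2 + h) - a) < (1::real)" "2 powr (a - (s / 2 + 2)) < (1::real)"
    using h p2 by (auto simp: powr_less_one)
  then have AB: "A \<ge> 0" "B \<ge> 0" using K by (auto simp: A_def B_def)
  show thesis
  proof (rule that[of "A / h + (s / 2 + 2) * B"])
    show "A / h + (s / 2 + 2) * B \<ge> 0" using AB h assms by simp
    fix t :: real assume t: "0 < t"
    let ?w = "\<lambda>x::real^'n. 2 * minkowski x (axis i 1)"
    define f where "f = (\<lambda>x::real^'n. (1 - theta t) * kern s (?w x + 0 * norm x) - kern s (?w x + t * norm x)
      + theta t * kern s (?w x + 2 * t * norm x))"
    define g1 where "g1 = (\<lambda>x. if 0 < ?w x \<and> ?w x \<le> t then ?w x powr (- (s / 2 + h)) else 0)"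
    define g2 where "g2 = (\<lambda>x. if t < ?w x then ?w x powr (- (s / 2 + 2)) else 0)"
    have [measurable]: "g1 \<in> borel_measurable borel" "g2 \<in> borel_measurable borel"
      unfolding g1_def g2_def by measurable
    have hb: "has_bochner_integral cone_ball_measure f ((1 - theta t) * kern_int i s 0 - kern_int i s t + theta t * kern_int i s (2 * t))"
      unfolding f_def using assms t
      by (intro has_bochner_integral_add has_bochner_integral_diff has_bochner_integral_mult_right
          has_bochner_integral_kern_int) auto
    have "AE x in cone_ball_measure. norm x > 0 \<and> norm x \<le> 1 \<and> minkowski x (axis i (1::real)) > 0"
      using assms by (intro AE_cone_ball_I AE_cone_minkowski_pos) auto
    then have "AE x in cone_ball_measure. ennreal (f x) \<le> ennreal (t powr h / h) * ennreal (g1 x) + ennreal ((s / 2 + 2) * t\<^sup>2) * ennreal (g2 x)"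
    proof eventually_elim
      case (elim x)
      have w: "0 < ?w x" "?w x \<le> 4" using elim minkowski_axis_le[of x i] by auto
      have "f x \<le> t powr h / h * g1 x + (s / 2 + 2) * t\<^sup>2 * g2 x"
        using defect_pointwise[of s "?w x" "norm x" t h] w elim t h assms by (auto simp: f_def g1_def g2_def)
      then have "ennreal (f x) \<le> ennreal (t powr h / h * g1 x + (s / 2 + 2) * t\<^sup>2 * g2 x)"
        by (rule ennreal_leI)
      also have "\<dots> = ennreal (t powr h / h) * ennreal (g1 x) + ennreal ((s / 2 + 2) * t\<^sup>2) * ennreal (g2 x)"
        using h assms by (simp add: g1_def g2_def flip: ennreal_mult ennreal_plus)
      finally show ?case .
    qed
    then have "(\<integral>\<^sup>+x. ennreal (f x) \<partial>cone_ball_measure) \<le>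
        (\<integral>\<^sup>+x. ennreal (t powr h / h) * ennreal (g1 x) + ennreal ((s / 2 + 2) * t\<^sup>2) * ennreal (g2 x) \<partial>cone_ball_measure)"
      by (rule nn_integral_mono_AE)
    also have "\<dots> = ennreal (t powr h / h) * (\<integral>\<^sup>+x. ennreal (g1 x) \<partial>cone_ball_measure) +
        ennreal ((s / 2 + 2) * t\<^sup>2) * (\<integral>\<^sup>+x. ennreal (g2 x) \<partial>cone_ball_measure)"
      by (simp add: nn_integral_add nn_integral_cmult)
    also have "\<dots> \<le> ennreal (t powr h / h) * ennreal (A * t powr (a - (s / 2 + h))) +
        ennreal ((s / 2 + 2) * t\<^sup>2) * ennreal (B * t powr (a - (s / 2 + 2)))"
    proof (intro add_mono mult_left_mono)
      have "(\<integral>\<^sup>+x. ennreal (g1 x) \<partial>cone_ball_measure) \<le> ennreal (2 powr (s / 2 + h) * K * t powr (a - (s / 2 + h)) / (1 - 2 powr ((s / 2 + h) - a)))"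
        unfolding g1_def by (rule nn_integral_powr_sublevel_le)
          (use emeasure_cone_ball_cap_le[of _ i] K h t assms in \<open>auto simp: K_def a_def\<close>)
      then show "(\<integral>\<^sup>+x. ennreal (g1 x) \<partial>cone_ball_measure) \<le> ennreal (A * t powr (a - (s / 2 + h)))"
        by (simp add: A_def)
      have "(\<integral>\<^sup>+x. ennreal (g2 x) \<partial>cone_ball_measure) \<le> ennreal (2 powr a * K * t powr (a - (s / 2 + 2)) / (1 - 2 powr (a - (s / 2 + 2))))"
        unfolding g2_def by (rule nn_integral_powr_superlevel_le)
          (use emeasure_cone_ball_cap_le[of _ i] K p2 t assms in \<open>auto simp: K_def a_def\<close>)
      then show "(\<integral>\<^sup>+x. ennreal (g2 x) \<partial>cone_ball_measure) \<le> ennreal (B * t powr (a - (s / 2 + 2)))"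
        by (simp add: B_def)
    qed auto
    also have "\<dots> = ennreal (t powr h / h * (A * t powr (a - (s / 2 + h))) +
        (s / 2 + 2) * t\<^sup>2 * (B * t powr (a - (s / 2 + 2))))"
      using AB h assms by (simp flip: ennreal_mult ennreal_plus)
    also have "t powr h / h * (A * t powr (a - (s / 2 + h))) + (s / 2 + 2) * t\<^sup>2 * (B * t powr (a - (s / 2 + 2)))
        = (A / h + (s / 2 + 2) * B) * t powr (a - s / 2)"
    proof -
      have "t powr h * t powr (a - (s / 2 + h)) = t powr (a - s / 2)" by (simp flip: powr_add)
      moreover have "t\<^sup>2 * t powr (a - (s / 2 + 2)) = t powr (a - s / 2)"
      proof -
        have "t\<^sup>2 * t powr (a - (s / 2 + 2)) = t powr 2 * t powr (a - (s / 2 + 2))" using t by simp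
        also have "\<dots> = t powr (2 + (a - (s / 2 + 2)))" by (rule powr_add[symmetric])
        finally show ?thesis by simp
      qed
      moreover have "t powr h / h * (A * t powr (a - (s / 2 + h))) + (s / 2 + 2) * t\<^sup>2 * (B * t powr (a - (s / 2 + 2)))
        = A / h * (t powr h * t powr (a - (s / 2 + h))) + (s / 2 + 2) * B * (t\<^sup>2 * t powr (a - (s / 2 + 2)))"
        by (simp add: mult_ac)
      ultimately show ?thesis by (simp add: distrib_right)
    qed
    finally have "integral\<^sup>L cone_ball_measure f \<le> (A / h + (s / 2 + 2) * B) * t powr (a - s / 2)"
      using hb AB h assms by (intro integral_le_of_nn_integral_le) (auto simp: has_bochner_integral_iff)
    then show "(1 - theta t) * kern_int i s 0 - kern_int i s t + theta t * kern_int i s (2 * t)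
      \<le> (A / h + (s / 2 + 2) * B) * t powr ((real (CARD('n) - 1) - s) / 2)"
      using hb by (simp add: has_bochner_integral_iff a_def diff_divide_distrib)
  qed
qed

section \<open>The bound at a greedy point\<close>

text \<open>\<open>norm (boost i t x)\<close> grows with \<open>t\<close>, so the domains of the
  boosted measures are nested.\<close>

lemma boosted_mono:
  fixes i :: "'n::finite" and f :: "real^'n \<Rightarrow> real"
  assumes "0 \<le> t" "t \<le> u" "integrable (boosted_measure i t) f" "integrable (boosted_measure i u) f"
    and "AE x in cone_measure. f x \<ge> 0"
  shows "integral\<^sup>L (boosted_measure i u) f \<le> integral\<^sup>L (boosted_measure i t) f"
proof -
  have [measurable]: "f \<in> borel_measurable borel"
    using borel_measurable_integrable[OF assms(3)] by simp
  have [measurable]: "(\<lambda>x. indicat_real (cball 0 1) (boost i v x)) \<in> borel_measurable borel" for v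
    using measurable_compose[OF measurable_boost borel_measurable_indicator_cball] .
  have int: "integrable cone_measure (\<lambda>x. indicat_real (cball 0 1) (boost i v x) * f x)"
    "integral\<^sup>L (boosted_measure i v) f = (LINT x|cone_measure. indicat_real (cball 0 1) (boost i v x) * f x)"
    if "integrable (boosted_measure i v) f" for v
    using that unfolding boosted_measure_def by (auto simp: integrable_real_density integral_real_density)
  have "(LINT x|cone_measure. indicat_real (cball 0 1) (boost i u x) * f x) \<le>
      (LINT x|cone_measure. indicat_real (cball 0 1) (boost i t x) * f x)"
  proof (rule integral_mono_AE)
    show "AE x in cone_measure. indicat_real (cball 0 1) (boost i u x) * f x \<le> indicat_real (cball 0 1) (boost i t x) * f x"
      using assms(5)
    proof eventually_elim
      case (elim x)
      have "t * norm x \<le> u * norm x" using assms by (intro mult_right_mono) auto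
      then have "norm (boost i t x) \<le> norm (boost i u x)"
        using assms by (simp add: norm_boost algebra_simps)
      then show ?case using elim by (auto simp: indicator_def)
    qed
  qed (use int assms in auto)
  then show ?thesis using int assms by simp
qed

text \<open>\<open>theta t\<close> is the quotient of the two bases and at most 1, so raising it to
  a power \<open>b \<le> 1\<close> can only increase it. For \<open>b = (d - s) / 2\<close> the
  condition \<open>b \<le> 1\<close> is \<open>d - 2 \<le> s\<close>.\<close>

lemma theta_powr_le:
  assumes "t > 0" "0 \<le> b" "b \<le> 1"
  shows "theta t * (2 * t * (4 + 2 * t)) powr b \<le> (t * (4 + t)) powr b"
proof -
  define D where "D = t * (4 + t)"
  define D' where "D' = 2 * t * (4 + 2 * t)"
  have D: "0 < D" "D \<le> D'" using assms by (auto simp: D_def D'_def intro!: mult_mono)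
  have "D' = t * (8 + 4 * t)" by (simp add: D'_def algebra_simps)
  then have th: "theta t = D / D'" using assms by (simp add: theta_def D_def)
  have "D / D' \<le> (D / D') powr b" using powr_mono'[of b 1 "D / D'"] D assms by auto
  also have "\<dots> = D powr b / D' powr b" using D by (simp add: powr_divide)
  finally have "D / D' \<le> D powr b / D' powr b" .
  then have "D / D' * D' powr b \<le> D powr b" using D by (simp add: pos_le_divide_eq)
  then show ?thesis using th by (simp add: D_def D'_def)
qed

text \<open>The excess of the potential over \<open>m\<close>, extended homogeneously to the cone,
  is non-negative, so its integrals over the nested boosted domains decrease. They are
  \<open>G\<close> up to scaling factors, whose quotient is controlled by
  \<open>theta\<close>.\<close>

lemma integral_kern_sum_ge:
  fixes i :: "'m::{finite,wellorder}" and y :: "'b \<Rightarrow> real^'m::{finite,wellorder}"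
  assumes card: "CARD('m) \<ge> 2" and s: "0 \<le> s" "real (CARD('m) - 1) - 2 \<le> s" "s < real (CARD('m) - 1)"
    and t: "t > 0" and J: "finite J" and y: "\<And>j. j \<in> J \<Longrightarrow> norm (y j) = 1"
    and m: "\<And>w. norm w = 1 \<Longrightarrow> (\<And>j. j \<in> J \<Longrightarrow> minkowski w (y j) > 0) \<Longrightarrow> m \<le> (\<Sum>j\<in>J. kern s (2 * minkowski w (y j)))"
  defines "M \<equiv> measure (cone_ball_measure :: (real^'m::{finite,wellorder}) measure) UNIV"
  defines "G \<equiv> \<lambda>t. (\<Sum>j\<in>J. (M + s * kern_int i s 0) * kern s (2 + t - 2 * y j $ i) + kern_int i s 0 - kern_int i s t)
      - m * (M + s * kern_int i s t)"
  shows "theta t * G (2 * t) \<le> G t"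
proof -
  define b where "b = (real (CARD('m) - 1) - s) / 2"
  define E where "E = (\<lambda>t::real. t * (4 + t))"
  have b: "0 \<le> b" "b \<le> 1" using s by (auto simp: b_def)
  define f where "f = (\<lambda>x. (\<Sum>j\<in>J. norm x powr (- s / 2) * kern s (2 * minkowski x (y j) / norm x)) - m * norm x powr (- s / 2))"
  have hb: "has_bochner_integral (boosted_measure i t) f (E t powr (- b) * G t)" if "t > 0" for t
  proof -
    have "has_bochner_integral (boosted_measure i t) f
      ((\<Sum>j\<in>J. E t powr (- b) * ((M + s * kern_int i s 0) * kern s (2 + t - 2 * y j $ i) + kern_int i s 0 - kern_int i s t))
       - m * (E t powr (- b) * (M + s * kern_int i s t)))"
    proof -
      have e: "- b = (s - real (CARD('m) - 1)) / 2" by (simp add: b_def field_simps)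
      show ?thesis unfolding f_def E_def e M_def
        using card s that y
        by (intro has_bochner_integral_diff has_bochner_integral_sum has_bochner_integral_mult_right
            boosted_kern boosted_one) auto
    qed
    then show ?thesis by (simp add: G_def sum_distrib_left right_diff_distrib mult_ac)
  qed
  have "AE x in cone_measure. \<forall>j\<in>J. minkowski x (y j) > 0"
  proof (rule AE_finite_allI[OF J])
    fix j assume "j \<in> J"
    then have "y j \<noteq> 0" using y[of j] by auto
    then show "AE x in cone_measure. minkowski x (y j) > 0" using card by (intro AE_cone_minkowski_pos) auto
  qed
  then have nonneg: "AE x in cone_measure. f x \<ge> 0" using AE_cone_nonzero
  proof eventually_elim
    case (elim x)
    define w where "w = x /\<^sub>R norm x"
    have w: "norm w = 1" using elim by (simp add: w_def)
    have mw: "minkowski w (y j) = minkowski x (y j) / norm x" for j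
      using elim by (simp add: w_def minkowski_def field_simps)
    have "m \<le> (\<Sum>j\<in>J. kern s (2 * minkowski w (y j)))" using elim by (intro m w) (auto simp: mw)
    then have "norm x powr (- s / 2) * m \<le> norm x powr (- s / 2) * (\<Sum>j\<in>J. kern s (2 * minkowski w (y j)))"
      by (intro mult_left_mono) auto
    then show ?case by (simp add: f_def mw sum_distrib_left mult.commute)
  qed
  have "integral\<^sup>L (boosted_measure i (2 * t)) f \<le> integral\<^sup>L (boosted_measure i t) f"
    using hb[of t] hb[of "2 * t"] t nonneg by (intro boosted_mono) (auto simp: has_bochner_integral_iff)
  then have le: "E (2 * t) powr (- b) * G (2 * t) \<le> E t powr (- b) * G t"
    using hb[of t] hb[of "2 * t"] t by (simp add: has_bochner_integral_iff)
  have E: "E t > 0" "E (2 * t) > 0" using t by (auto simp: E_def)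
  have "AE x in boosted_measure i (2 * t). norm x > 0 \<and> norm (boost i (2 * t) x) \<le> 1 \<and> f x \<ge> 0"
    by (intro AE_boosted_I nonneg)
  then have "AE x in boosted_measure i (2 * t). f x \<ge> 0" by eventually_elim simp
  then have "integral\<^sup>L (boosted_measure i (2 * t)) f \<ge> 0" by (rule integral_nonneg_AE)
  \<comment> \<open>The sign is what permits lowering the weight of \<open>G (2 * t)\<close> to
    \<open>theta t\<close>.\<close>
  then have g2: "G (2 * t) \<ge> 0"
    using hb[of "2 * t"] t E by (simp add: has_bochner_integral_iff zero_le_mult_iff)
  have "theta t * E (2 * t) powr b \<le> E t powr b"
    using theta_powr_le[OF t b] by (simp add: E_def)
  then have "theta t * E (2 * t) powr b * (E (2 * t) powr (- b) * G (2 * t)) \<le> E t powr b * (E (2 * t) powr (- b) * G (2 * t))"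
    using g2 by (intro mult_right_mono) auto
  also have "\<dots> \<le> E t powr b * (E t powr (- b) * G t)" by (intro mult_left_mono le) auto
  finally have "theta t * E (2 * t) powr b * (E (2 * t) powr (- b) * G (2 * t)) \<le> E t powr b * (E t powr (- b) * G t)" .
  moreover have "E u powr b * (E u powr (- b) * z) = z" if "E u > 0" for u z
    using that by (simp flip: mult.assoc powr_add)
  ultimately show ?thesis using E by (simp only: mult.assoc)
qed

lemma kern_one: "kern s 1 = 0"
  by (simp add: kern_def)

text \<open>In \<open>theta t * G (2 * t) \<le> G t\<close> every point except \<open>y l\<close>
  contributes, by convexity, with a sign that allows it to be dropped. What remains compares the
  kernel at \<open>y l\<close> with its regularisation, up to the defect of \<open>kern_int\<close>
  times the a priori bound on the minimum.\<close>

lemma greedy_point_bound: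
  fixes i :: "'m::{finite,wellorder}"
  assumes card: "CARD('m) \<ge> 2" and s: "0 \<le> s" "real (CARD('m) - 1) - 2 \<le> s" "s < real (CARD('m) - 1)"
  obtains K where "K \<ge> 0" "\<And>J (y :: nat \<Rightarrow> real^'m::{finite,wellorder}) t l.
      finite J \<Longrightarrow> t > 0 \<Longrightarrow> (\<And>j. j \<in> J \<Longrightarrow> norm (y j) = 1 \<and> minkowski (axis i 1) (y j) > 0) \<Longrightarrow>
      (\<And>w. norm w = 1 \<Longrightarrow> (\<And>j. j \<in> J \<Longrightarrow> minkowski w (y j) > 0) \<Longrightarrow>
         (\<Sum>j\<in>J. kern s (2 * minkowski (axis i 1) (y j))) \<le> (\<Sum>j\<in>J. kern s (2 * minkowski w (y j)))) \<Longrightarrow> l \<in> J \<Longrightarrow>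
      kern s (2 * minkowski (axis i 1) (y l)) \<le>
        kern s t + t powr (- s / 2) / 2 + K * t powr ((real (CARD('m) - 1) - s) / 2) * real (card J)"
proof -
  define M where "M = measure (cone_ball_measure :: (real^'m::{finite,wellorder}) measure) UNIV"
  have M: "M > 0" unfolding M_def by (rule measure_cone_ball_pos[OF card])
  define I where "I = kern_int i s"
  define c where "c = M + s * I 0"
  obtain C where C: "C \<ge> 0" "\<And>t. 0 < t \<Longrightarrow> (1 - theta t) * I 0 - I t + theta t * I (2 * t)
      \<le> C * t powr ((real (CARD('m) - 1) - s) / 2)"
    using kern_int_defect[of s i] card s unfolding I_def by blast
  show thesis
  proof (rule that[of "2 * C / M"])
    show "2 * C / M \<ge> 0" using C M by simp
    fix J :: "nat set" and y :: "nat \<Rightarrow> real^'m::{finite,wellorder}" and t :: real and l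
    assume J: "finite J" and t: "t > 0" and l: "l \<in> J"
      and y: "\<And>j. j \<in> J \<Longrightarrow> norm (y j) = 1 \<and> minkowski (axis i 1) (y j) > 0"
      and min: "\<And>w. norm w = 1 \<Longrightarrow> (\<And>j. j \<in> J \<Longrightarrow> minkowski w (y j) > 0) \<Longrightarrow>
         (\<Sum>j\<in>J. kern s (2 * minkowski (axis i 1) (y j))) \<le> (\<Sum>j\<in>J. kern s (2 * minkowski w (y j)))"
    interpret finite_measure "cone_ball_measure :: (real^'m::{finite,wellorder}) measure" by (rule finite_measure_cone_ball[OF card])
    define w where "w = (\<lambda>j. 2 * minkowski (axis i 1) (y j))"
    define m where "m = (\<Sum>j\<in>J. kern s (w j))"
    define N where "N = real (card J)"
    define th where "th = theta t"
    define T where "T = t powr ((real (CARD('m) - 1) - s) / 2)"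
    note th = theta_bounds[OF t, folded th_def]
    have w: "w j > 0" "2 + u - 2 * y j $ i = w j + u" if "j \<in> J" for j u
      using y[OF that] by (auto simp: w_def minkowski_def inner_commute inner_axis)
    have m_min: "m \<le> (\<Sum>j\<in>J. kern s (2 * minkowski v (y j)))" if "norm v = 1" "\<And>j. j \<in> J \<Longrightarrow> minkowski v (y j) > 0" for v
      using min[OF that] by (simp add: m_def w_def)
    \<comment> \<open>A priori bound on the minimum: minimality is averaged over the
      rotation-invariant measure. It also forces \<open>c > 0\<close>.\<close>
    have avg: "(N + s * m) * M \<le> N * c"
    proof -
      have hb: "has_bochner_integral cone_ball_measure (\<lambda>x. \<Sum>j\<in>J. 1 + s * kern s (2 * minkowski x (y j))) (\<Sum>j\<in>J. c)"
      proof (rule has_bochner_integral_sum)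
        fix j assume j: "j \<in> J"
        then have "norm (y j) = 1" "y j \<noteq> 0" using y[of j] by auto
        then have "has_bochner_integral cone_ball_measure (\<lambda>x. kern s (2 * minkowski x (y j))) (I 0)"
          using has_bochner_integral_cone_ball_kern[of s "y j" i] card s by (simp add: I_def kern_one)
        then show "has_bochner_integral cone_ball_measure (\<lambda>x. 1 + s * kern s (2 * minkowski x (y j))) c"
          unfolding c_def by (intro has_bochner_integral_add has_bochner_integral_mult_right)
            (auto simp: has_bochner_integral_iff M_def)
      qed
      have "AE x in cone_measure. \<forall>j\<in>J. minkowski x (y j) > 0"
      proof (rule AE_finite_allI[OF J])
        fix j assume "j \<in> J"
        then have "y j \<noteq> 0" using y[of j] by auto
        then show "AE x in cone_measure. minkowski x (y j) > 0" using card by (intro AE_cone_minkowski_pos) auto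
      qed
      from AE_cone_ball_I[OF this]
      have AE: "AE x in cone_ball_measure. N + s * m \<le> (\<Sum>j\<in>J. 1 + s * kern s (2 * minkowski x (y j)))"
      proof eventually_elim
        case (elim x)
        define v where "v = x /\<^sub>R norm x"
        have v: "norm v = 1" using elim by (simp add: v_def)
        have mv: "minkowski v (y j) = minkowski x (y j) / norm x" for j
          using elim by (simp add: v_def minkowski_def field_simps)
        have "m \<le> (\<Sum>j\<in>J. kern s (2 * minkowski v (y j)))" using elim by (intro m_min v) (auto simp: mv)
        \<comment> \<open>Undoing the normalisation is free, since \<open>norm x \<le> 1\<close> and
          the kernel decreases.\<close>
        also have "\<dots> \<le> (\<Sum>j\<in>J. kern s (2 * minkowski x (y j)))"
        proof (rule sum_mono)
          fix j assume "j \<in> J"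
          then have "0 < minkowski x (y j)" using elim by auto
          moreover from this have "minkowski x (y j) \<le> minkowski v (y j)"
            using elim by (simp add: mv pos_le_divide_eq mult_left_le)
          ultimately show "kern s (2 * minkowski v (y j)) \<le> kern s (2 * minkowski x (y j))"
            by (intro kern_antimono) auto
        qed
        finally have "s * m \<le> s * (\<Sum>j\<in>J. kern s (2 * minkowski x (y j)))" using s by (intro mult_left_mono) auto
        then show ?case by (simp add: sum.distrib sum_distrib_left N_def)
      qed
      have "(LINT x|(cone_ball_measure :: (real^'m::{finite,wellorder}) measure). N + s * m) \<le>
          (LINT x|cone_ball_measure. (\<Sum>j\<in>J. 1 + s * kern s (2 * minkowski x (y j))))"
        using hb by (intro integral_mono_AE AE) (auto simp: has_bochner_integral_iff)
      then show ?thesis using hb by (simp add: has_bochner_integral_iff M_def N_def mult.commute)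
    qed
    have pos: "N + s * m > 0"
    proof -
      have "N + s * m = (\<Sum>j\<in>J. 1 + s * kern s (w j))" by (simp add: sum.distrib sum_distrib_left N_def m_def)
      also have "\<dots> = (\<Sum>j\<in>J. w j powr (- s / 2))" by (intro sum.cong refl powr_eq_kern[symmetric] w(1))
      also have "\<dots> > 0"
      proof (rule sum_pos)
        fix j assume "j \<in> J"
        from w(1)[OF this] show "0 < w j powr (- s / 2)" by simp
      qed (use J l in auto)
      finally show ?thesis .
    qed
    have "N > 0" using J l by (auto simp: N_def card_gt_0_iff)
    then have c: "c > 0" using avg mult_pos_pos[OF pos M] by (smt (verit) mult_nonneg_nonpos)
    define E where "E = (1 - th) * I 0 - I t + th * I (2 * t)"
    have E: "E \<le> C * T" using C(2)[OF t] by (simp add: E_def th_def T_def)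
    define q where "q = (\<lambda>j. kern s (w j + t) - th * kern s (w j + 2 * t))"
    have "th * ((\<Sum>j\<in>J. c * kern s (w j + 2 * t) + I 0 - I (2 * t)) - m * (M + s * I (2 * t)))
        \<le> (\<Sum>j\<in>J. c * kern s (w j + t) + I 0 - I t) - m * (M + s * I t)"
      using integral_kern_sum_ge[of s t J y m i] card s t J y m_min w(2)
      by (simp add: c_def I_def M_def th_def cong: sum.cong)
    \<comment> \<open>All values of \<open>I\<close> combine into the one defect \<open>E\<close>,
      with weight \<open>N\<close> from the potentials and \<open>s * m\<close> from the
      masses.\<close>
    then have "0 \<le> c * (\<Sum>j\<in>J. q j) - m * (1 - th) * c + E * (N + s * m)"
      unfolding q_def E_def c_def
      by (simp add: sum.distrib sum_subtractf sum_distrib_left N_def algebra_simps)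
    also have "c * (\<Sum>j\<in>J. q j) - m * (1 - th) * c = c * (\<Sum>j\<in>J. q j - (1 - th) * kern s (w j))"
    proof -
      have e: "(\<Sum>j\<in>J. q j - (1 - th) * kern s (w j)) = (\<Sum>j\<in>J. q j) - (1 - th) * m"
        unfolding m_def sum_subtractf sum_distrib_left by simp
      show ?thesis unfolding e by (simp add: right_diff_distrib mult_ac)
    qed
    also have "(\<Sum>j\<in>J. q j - (1 - th) * kern s (w j)) \<le> q l - (1 - th) * kern s (w l)"
    proof -
      have "(\<Sum>j\<in>J - {l}. q j - (1 - th) * kern s (w j)) \<le> 0"
      proof (rule sum_nonpos)
        fix j assume "j \<in> J - {l}"
        then show "q j - (1 - th) * kern s (w j) \<le> 0"
          using kern_theta_le[of s "w j" t th] s t th w(1)[of j] by (simp add: q_def)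
      qed
      then show ?thesis using J l by (simp add: sum.remove)
    qed
    finally have "0 \<le> c * (q l - (1 - th) * kern s (w l)) + E * (N + s * m)" using c by simp
    moreover have "E * (N + s * m) \<le> C * T * (N * c / M)"
    proof -
      have "E * (N + s * m) \<le> C * T * (N + s * m)" using E pos by (intro mult_right_mono) auto
      also have "\<dots> \<le> C * T * (N * c / M)"
        using avg M C by (intro mult_left_mono) (auto simp: pos_le_divide_eq T_def)
      finally show ?thesis .
    qed
    ultimately have "0 \<le> c * (q l - (1 - th) * kern s (w l) + C * T * N / M)" by (simp add: algebra_simps)
    then have "(1 - th) * kern s (w l) \<le> q l + C * T * N / M" using c by (simp add: zero_le_mult_iff)
    \<comment> \<open>Only \<open>w l + t \<ge> t\<close> is used: regularisation caps the kernel at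
      its value at \<open>t\<close>, at the price of one first difference.\<close>
    also have "q l \<le> (1 - th) * (kern s t + t powr (- s / 2) / 2)"
    proof -
      have wl: "w l > 0" using w(1)[OF l] .
      have "kern s (w l + t) - kern s ((w l + t) + t) \<le> t / 2 * (w l + t) powr (- s / 2 - 1)"
        using s t wl by (intro kern_diff_bounds) auto
      also have "\<dots> \<le> t / 2 * t powr (- s / 2 - 1)"
        using s t wl by (intro mult_left_mono powr_mono2') auto
      also have "\<dots> = t powr (- s / 2) / 2"
        using powr_mult_base[of t "- s / 2 - 1"] t by simp
      finally have d: "kern s (w l + t) - kern s (w l + 2 * t) \<le> t powr (- s / 2) / 2" by (simp add: add.assoc)
      have "q l = (1 - th) * kern s (w l + t) + th * (kern s (w l + t) - kern s (w l + 2 * t))"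
        by (simp add: q_def algebra_simps)
      also have "\<dots> \<le> (1 - th) * kern s t + th * (t powr (- s / 2) / 2)"
        using d th t wl by (intro add_mono mult_left_mono kern_antimono) auto
      also have "th * (t powr (- s / 2) / 2) \<le> (1 - th) * (t powr (- s / 2) / 2)"
        using th by (intro mult_right_mono) auto
      finally show ?thesis by (simp add: algebra_simps)
    qed
    \<comment> \<open>The factor 2 in the constant compensates
      \<open>1 - th \<ge> 1 / 2\<close>.\<close>
    also have "C * T * N / M \<le> (1 - th) * (2 * C / M * T * N)"
    proof -
      have "1 / 2 * (2 * C / M * T * N) \<le> (1 - th) * (2 * C / M * T * N)"
        using th C M \<open>N > 0\<close> by (intro mult_right_mono) (auto simp: T_def)
      then show ?thesis by simp
    qed
    finally have "(1 - th) * kern s (w l) \<le> (1 - th) * (kern s t + t powr (- s / 2) / 2 + 2 * C / M * T * N)"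
      by (simp add: distrib_left)
    then have "kern s (w l) \<le> kern s t + t powr (- s / 2) / 2 + 2 * C / M * T * N"
      using th by simp
    then show "kern s (2 * minkowski (axis i 1) (y l)) \<le> kern s t + t powr (- s / 2) / 2 +
        2 * C / M * t powr ((real (CARD('m) - 1) - s) / 2) * real (card J)"
      by (simp add: w_def T_def N_def)
  qed
qed

section \<open>Greedy sequences\<close>

lemma kern_le_imp_ge:
  assumes "s \<ge> 0" "K \<ge> 0"
  obtains c where "c > 0" "\<And>u. u > 0 \<Longrightarrow> kern s u \<le> K \<Longrightarrow> c \<le> u"
proof (cases "s = 0")
  case True
  show thesis
  proof (rule that[of "exp (- 2 * K)"])
    fix u :: real assume u: "u > 0" "kern s u \<le> K"
    then have "- 2 * K \<le> ln u" using True by (simp add: kern_def)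
    then show "exp (- 2 * K) \<le> u" using u by (simp only: ln_ge_iff)
  qed simp
next
  case False
  then have s: "s > 0" using assms by simp
  have K: "1 + s * K > 0" using assms by (simp add: add_pos_nonneg)
  show thesis
  proof (rule that[of "(1 + s * K) powr (- 2 / s)"])
    show "(1 + s * K) powr (- 2 / s) > 0" using K by simp
    fix u :: real assume u: "u > 0" "kern s u \<le> K"
    have "u powr (- s / 2) \<le> 1 + s * K"
      unfolding powr_eq_kern[OF u(1)] using u s by simp
    then have "(1 + s * K) powr (- 2 / s) \<le> (u powr (- s / 2)) powr (- 2 / s)"
      using s u by (intro powr_mono2') auto
    also have "\<dots> = u" using s u by (simp add: powr_powr)
    finally show "(1 + s * K) powr (- 2 / s) \<le> u" .
  qed
qed

lemma norm_diff_eq_minkowski: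
  assumes "norm x = 1" "norm y = 1"
  shows "(norm (x - y))\<^sup>2 = 2 * minkowski x y"
proof -
  have "(norm (x - y))\<^sup>2 = (norm x)\<^sup>2 + (norm y)\<^sup>2 - 2 * (x \<bullet> y)"
    by (simp add: power2_norm_eq_inner inner_diff inner_commute)
  then show ?thesis using assms by (simp add: minkowski_def)
qed

lemma riesz_kernel_eq_kern:
  assumes "x \<noteq> y"
  shows "riesz_kernel s x y = ereal (kern s ((norm (x - y))\<^sup>2) + (if s = 0 then 0 else 1 / s))"
proof -
  define r where "r = norm (x - y)"
  have r: "r > 0" using assms by (simp add: r_def)
  have "ln (r\<^sup>2) = 2 * ln r" using r by (simp add: ln_realpow)
  moreover have "(r\<^sup>2) powr (- s / 2) = r powr (- s)"
  proof -
    have "(r\<^sup>2) powr (- s / 2) = (r powr 2) powr (- s / 2)" using r by simp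
    also have "\<dots> = r powr (- s)" by (subst powr_powr) simp
    finally show ?thesis .
  qed
  ultimately show ?thesis
    using assms unfolding riesz_kernel_def kern_def r_def[symmetric] by (simp add: diff_divide_distrib)
qed

lemma greedy_sphere:
  assumes "greedy_energy_sequence s x" "n \<ge> 1"
  shows "norm (x n) = 1"
proof (cases "n = 1")
  case True
  then show ?thesis using assms by (simp add: greedy_energy_sequence_def)
next
  case False
  then have "n = (n - 1) + 1" "n - 1 \<ge> 1" using assms(2) by auto
  then have "x n \<in> sphere 0 1"
    using assms(1) unfolding greedy_energy_sequence_def is_arg_min_def by metis
  then show ?thesis by simp
qed

text \<open>At an earlier point the sum is \<infinity>, while the infinite sphere offers points
  where it is finite. So the extended-real minimisation reduces to a real one, in which the constant
  shift of the kernel cancels.\<close>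

lemma greedy_min:
  fixes x :: "nat \<Rightarrow> 'a::euclidean_space"
  assumes g: "greedy_energy_sequence s x" and N: "N \<ge> 1" and s: "s \<ge> 0" and dim: "DIM('a) \<ge> 2"
  shows "l \<in> {1..N} \<Longrightarrow> x (N + 1) \<noteq> x l"
    and "norm w = 1 \<Longrightarrow> (\<And>j. j \<in> {1..N} \<Longrightarrow> w \<noteq> x j) \<Longrightarrow>
      (\<Sum>j=1..N. kern s ((norm (x (N + 1) - x j))\<^sup>2)) \<le> (\<Sum>j=1..N. kern s ((norm (w - x j))\<^sup>2))"
proof -
  define f where "f = (\<lambda>y. \<Sum>j=1..N. riesz_kernel s y (x j))"
  define k where "k = (if s = 0 then 0 else 1 / s)"
  have min: "\<not> f y < f (x (N + 1))" if "norm y = 1" for y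
    using g N that by (auto simp: greedy_energy_sequence_def is_arg_min_def f_def)
  have fin: "f y = ereal ((\<Sum>j=1..N. kern s ((norm (y - x j))\<^sup>2)) + real N * k)"
    if "\<And>j. j \<in> {1..N} \<Longrightarrow> y \<noteq> x j" for y
  proof -
    have "f y = (\<Sum>j=1..N. ereal (kern s ((norm (y - x j))\<^sup>2) + k))"
      unfolding f_def k_def using that by (intro sum.cong) (auto simp: riesz_kernel_eq_kern)
    then show ?thesis by (simp add: sum.distrib)
  qed
  have ne: "x (N + 1) \<noteq> x l" if l: "l \<in> {1..N}" for l
  proof
    assume eq: "x (N + 1) = x l"
    have "infinite (sphere (0::'a) 1)"
    proof -
      obtain u :: 'a where u: "norm u = 1" using vector_choose_size[of 1] by auto
      have "connected (sphere (0::'a) 1)" using dim by (intro connected_sphere) auto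
      moreover have "sphere (0::'a) 1 \<noteq> {u}"
      proof
        assume "sphere 0 1 = {u}"
        moreover have "- u \<in> sphere 0 1" using u by simp
        ultimately have "- u = u" by blast
        then have "u + u = 0" by (metis add.right_inverse)
        then have "u = 0" by (simp flip: scaleR_2)
        then show False using u by simp
      qed
      moreover have "u \<in> sphere 0 1" using u by simp
      ultimately show ?thesis using connected_finite_iff_sing[of "sphere (0::'a) 1"]
        by (metis empty_iff singletonD)
    qed
    then obtain y where y: "y \<in> sphere 0 1" "y \<notin> x ` {1..N}"
      using finite_subset[of "sphere 0 1" "x ` {1..N}"] by blast
    have "f (x (N + 1)) = \<infinity>"
    proof -
      have "\<bar>riesz_kernel s (x (N + 1)) (x l)\<bar> = \<infinity>" "riesz_kernel s (x (N + 1)) (x l) = \<infinity>"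
        using eq s by (auto simp: riesz_kernel_def)
      moreover have "riesz_kernel s a b \<noteq> - \<infinity>" for a b :: 'a by (auto simp: riesz_kernel_def)
      ultimately show ?thesis using l unfolding f_def by (subst sum_Pinfty) auto
    qed
    moreover have "f y < \<infinity>"
    proof -
      have "y \<noteq> x j" if "j \<in> {1..N}" for j using y that by auto
      from fin[OF this] show ?thesis by simp
    qed
    ultimately show False using min[of y] y by simp
  qed
  show "l \<in> {1..N} \<Longrightarrow> x (N + 1) \<noteq> x l" by (rule ne)
  show "(\<Sum>j=1..N. kern s ((norm (x (N + 1) - x j))\<^sup>2)) \<le> (\<Sum>j=1..N. kern s ((norm (w - x j))\<^sup>2))"
    if "norm w = 1" "\<And>j. j \<in> {1..N} \<Longrightarrow> w \<noteq> x j"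
    using min[OF that(1)] fin[of w] fin[of "x (N + 1)"] ne that by (simp add: not_less)
qed

lemma minkowski_pos_iff:
  assumes "norm x = 1" "norm y = 1"
  shows "minkowski x y > 0 \<longleftrightarrow> x \<noteq> y"
  using norm_diff_eq_minkowski[OF assms] by (metis minkowski_nonneg less_le mult_eq_0_iff power_eq_0_iff
      norm_eq_zero right_minus_eq zero_neq_numeral zero_less_numeral)

lemma greedy_step_separation:
  fixes x :: "nat \<Rightarrow> real^'m::{finite,wellorder}"
  assumes d: "CARD('m) = d + 1" "d \<ge> 2" "real d - 2 \<le> s" "s < real d"
    and g: "greedy_energy_sequence s x"
  obtains c where "c > 0" "\<And>N l. N \<ge> 1 \<Longrightarrow> l \<in> {1..N} \<Longrightarrow> norm (x (N + 1) - x l) \<ge> c * real N powr (- 1 / real d)"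
proof -
  define i :: 'm where "i = undefined"
  have s: "s \<ge> 0" using d by simp
  obtain K where K: "K \<ge> 0" "\<And>J (y :: nat \<Rightarrow> real^'m::{finite,wellorder}) t l.
      finite J \<Longrightarrow> t > 0 \<Longrightarrow> (\<And>j. j \<in> J \<Longrightarrow> norm (y j) = 1 \<and> minkowski (axis i 1) (y j) > 0) \<Longrightarrow>
      (\<And>w. norm w = 1 \<Longrightarrow> (\<And>j. j \<in> J \<Longrightarrow> minkowski w (y j) > 0) \<Longrightarrow>
         (\<Sum>j\<in>J. kern s (2 * minkowski (axis i 1) (y j))) \<le> (\<Sum>j\<in>J. kern s (2 * minkowski w (y j)))) \<Longrightarrow> l \<in> J \<Longrightarrow>
      kern s (2 * minkowski (axis i 1) (y l)) \<le>
        kern s t + t powr (- s / 2) / 2 + K * t powr ((real (CARD('m) - 1) - s) / 2) * real (card J)"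
    using greedy_point_bound[of s i] d s by auto
  obtain c where c: "c > 0" "\<And>u. u > 0 \<Longrightarrow> kern s u \<le> K + 1 / 2 \<Longrightarrow> c \<le> u"
    using kern_le_imp_ge[of s "K + 1 / 2"] s K(1) by auto
  show thesis
  proof (rule that[of "sqrt c"])
    show "sqrt c > 0" using c by simp
    fix N l :: nat assume N: "N \<ge> 1" and l: "l \<in> {1..N}"
    define z where "z = x (N + 1)"
    \<comment> \<open>The squared typical spacing of \<open>N\<close> points; it makes
      \<open>t powr ((d - s) / 2) * N\<close> equal to \<open>t powr (- s / 2)\<close>, so all error
      terms have the same order.\<close>
    define t where "t = real N powr (- 2 / real d)"
    have t: "t > 0" using N by (simp add: t_def)
    have nx: "norm (x j) = 1" if "j \<ge> 1" for j using greedy_sphere[OF g that] .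
    have nz: "norm z = 1" unfolding z_def by (rule nx) simp
    have ne: "z \<noteq> x j" if "j \<in> {1..N}" for j
      unfolding z_def using greedy_min(1)[OF g N s _ that] d by simp
    \<comment> \<open>Rotates the new point to the pole of the boosts.\<close>
    obtain f where f: "orthogonal_transformation f" "f z = axis i (1::real)"
      using orthogonal_transformation_exists[of z "axis i 1"] nz by auto
    have r2: "(norm (z - x j))\<^sup>2 = 2 * minkowski (axis i 1) (f (x j))" if "j \<in> {1..N}" for j
      using norm_diff_eq_minkowski[OF nz nx[of j]] that minkowski_orthogonal[OF f(1), of z "x j"] f(2) by simp
    have "kern s (2 * minkowski (axis i 1) (f (x l))) \<le>
        kern s t + t powr (- s / 2) / 2 + K * t powr ((real (CARD('m) - 1) - s) / 2) * real (card {1..N})"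
    proof (rule K(2)[of _ _ "\<lambda>j. f (x j)"])
      fix j assume j: "j \<in> {1..N}"
      have "minkowski z (x j) > 0" using minkowski_pos_iff[OF nz nx[of j]] ne[OF j] j by simp
      then show "norm (f (x j)) = 1 \<and> minkowski (axis i 1) (f (x j)) > 0"
        using j nx[of j] minkowski_orthogonal[OF f(1), of z "x j"] f by (simp add: orthogonal_transformation_norm)
    next
      fix w :: "real^'m::{finite,wellorder}"
      assume w: "norm w = 1" "\<And>j. j \<in> {1..N} \<Longrightarrow> minkowski w (f (x j)) > 0"
      define v where "v = inv f w"
      have fv: "f v = w" unfolding v_def
        using orthogonal_transformation_surj[OF f(1)] by (simp add: surj_f_inv_f)
      have nv: "norm v = 1" using orthogonal_transformation_norm[OF f(1), of v] fv w by simp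
      have mv: "minkowski w (f (x j)) = minkowski v (x j)" for j
        using minkowski_orthogonal[OF f(1), of v "x j"] fv by simp
      have r: "(norm (v - x j))\<^sup>2 = 2 * minkowski w (f (x j))" if "j \<in> {1..N}" for j
        using norm_diff_eq_minkowski[OF nv nx[of j]] that mv by simp
      have "v \<noteq> x j" if "j \<in> {1..N}" for j
        using w(2)[OF that] mv[of j] minkowski_pos_iff[OF nv nx[of j]] that by simp
      then have "(\<Sum>j=1..N. kern s ((norm (z - x j))\<^sup>2)) \<le> (\<Sum>j=1..N. kern s ((norm (v - x j))\<^sup>2))"
        unfolding z_def using greedy_min(2)[OF g N s _ nv] d by simp
      moreover have "(\<Sum>j=1..N. kern s ((norm (z - x j))\<^sup>2)) = (\<Sum>j\<in>{1..N}. kern s (2 * minkowski (axis i 1) (f (x j))))"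
        by (intro sum.cong refl) (simp only: r2)
      moreover have "(\<Sum>j=1..N. kern s ((norm (v - x j))\<^sup>2)) = (\<Sum>j\<in>{1..N}. kern s (2 * minkowski w (f (x j))))"
        by (intro sum.cong refl) (simp only: r)
      ultimately show "(\<Sum>j\<in>{1..N}. kern s (2 * minkowski (axis i 1) (f (x j)))) \<le> (\<Sum>j\<in>{1..N}. kern s (2 * minkowski w (f (x j))))"
        by simp
    qed (use t l in auto)
    then have "kern s ((norm (z - x l))\<^sup>2) \<le>
        kern s t + t powr (- s / 2) / 2 + K * (t powr ((real d - s) / 2) * real N)"
      using r2[OF l] d by (simp add: mult.assoc)
    also have "t powr ((real d - s) / 2) * real N = t powr (- s / 2)"
    proof -
      have "t powr ((real d - s) / 2) * real N = real N powr (- 2 / real d * ((real d - s) / 2)) * real N powr 1"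
        using N by (simp add: t_def powr_powr)
      also have "\<dots> = real N powr (- 2 / real d * ((real d - s) / 2) + 1)" by (simp only: powr_add)
      also have "- 2 / real d * ((real d - s) / 2) + 1 = - 2 / real d * (- s / 2)"
        using d by (simp add: field_simps)
      also have "real N powr \<dots> = t powr (- s / 2)" unfolding t_def by (simp only: powr_powr)
      finally show ?thesis .
    qed
    finally have "kern s ((norm (z - x l))\<^sup>2) - kern s t \<le> t powr (- s / 2) * (K + 1 / 2)"
      by (simp add: algebra_simps)
    moreover have "(norm (z - x l))\<^sup>2 > 0" using ne[OF l] by simp
    \<comment> \<open>The scaling law of \<open>kern\<close> turns the bound into one on the squared
      distance in units of \<open>t\<close>, free of \<open>N\<close>.\<close>
    ultimately have "t powr (- s / 2) * kern s ((norm (z - x l))\<^sup>2 / t) \<le> t powr (- s / 2) * (K + 1 / 2)"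
      using kern_divide[OF t] by simp
    then have "kern s ((norm (z - x l))\<^sup>2 / t) \<le> K + 1 / 2" using t by simp
    then have "c \<le> (norm (z - x l))\<^sup>2 / t" using ne[OF l] t by (intro c) auto
    then have "c * t \<le> (norm (z - x l))\<^sup>2" using t by (simp add: field_simps)
    then have "sqrt (c * t) \<le> norm (z - x l)" by (rule real_le_lsqrt[rotated -1]) auto
    moreover have "sqrt t = real N powr (- 1 / real d)"
      using N by (simp add: t_def powr_half_sqrt[symmetric] powr_powr)
    ultimately show "norm (x (N + 1) - x l) \<ge> sqrt c * real N powr (- 1 / real d)"
      by (simp add: real_sqrt_mult z_def)
  qed
qed

lemma well_separated_wellorder:
  fixes x :: "nat \<Rightarrow> real^'m::{finite,wellorder}"
  assumes d: "CARD('m) = d + 1" "d \<ge> 2" "real d - 2 \<le> s" "s < real d"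
    and g: "greedy_energy_sequence s x"
  shows "well_separated d x"
proof -
  obtain c where c: "c > 0" "\<And>N l. N \<ge> 1 \<Longrightarrow> l \<in> {1..N} \<Longrightarrow> norm (x (N + 1) - x l) \<ge> c * real N powr (- 1 / real d)"
    using greedy_step_separation[OF assms] by blast
  have sep: "c * real N powr (- 1 / real d) \<le> norm (x j - x i)" if "i \<in> {1..N}" "j \<in> {1..N}" "i < j" for i j N
  proof -
    \<comment> \<open>The later point was chosen against \<open>j - 1 \<le> N\<close> points, and
      the exponent is negative, so the bound obtained then is the stronger one.\<close>
    have j: "j = (j - 1) + 1" "j - 1 \<ge> 1" "i \<in> {1..j - 1}" using that by auto
    have "real N powr (- 1 / real d) \<le> real (j - 1) powr (- 1 / real d)"
      using that d j by (intro powr_mono2') auto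
    then have "c * real N powr (- 1 / real d) \<le> c * real (j - 1) powr (- 1 / real d)"
      using c by simp
    also have "\<dots> \<le> norm (x j - x i)" using c(2)[OF j(2,3)] j(1) by simp
    finally show ?thesis .
  qed
  have "ereal (c * real N powr (- 1 / real d)) \<le> separation_distance x N" for N
    unfolding separation_distance_def
  proof (rule INF_greatest, clarify)
    fix i j assume ij: "i \<in> {1..N}" "j \<in> {1..N}" "i \<noteq> j"
    show "ereal (c * real N powr (- 1 / real d)) \<le> ereal (norm (x i - x j))"
      using sep[of i N j] sep[of j N i] ij by (cases "i < j") (auto simp: norm_minus_commute)
  qed
  then show ?thesis using c(1) by (auto simp: well_separated_def)
qed

text \<open>
  The change of variables theorem of HOL-Analysis requires a well-ordered index type, so the
  coordinates are relabelled.
\<close>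

typedef (overloaded) ('n::finite) idx = "{..<CARD('n)}"
  by (intro exI[of _ 0]) simp

instantiation idx :: (finite) linorder
begin

definition less_eq_idx :: "'a idx \<Rightarrow> 'a idx \<Rightarrow> bool" where
  "less_eq_idx a b \<longleftrightarrow> Rep_idx a \<le> Rep_idx b"

definition less_idx :: "'a idx \<Rightarrow> 'a idx \<Rightarrow> bool" where
  "less_idx a b \<longleftrightarrow> Rep_idx a < Rep_idx b"

instance
  by standard (auto simp: less_eq_idx_def less_idx_def Rep_idx_inject)

end

instance idx :: (finite) wellorder
proof
  fix P :: "'a idx \<Rightarrow> bool" and a :: "'a idx"
  assume "\<And>a. (\<And>b. b < a \<Longrightarrow> P b) \<Longrightarrow> P a"
  then show "P a"
    by (induction "Rep_idx a" arbitrary: a rule: less_induct) (metis less_idx_def)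
qed

instance idx :: (finite) finite
proof
  have "(UNIV :: 'a idx set) = Abs_idx ` {..<CARD('a)}"
    using type_definition.Abs_image[OF type_definition_idx] by metis
  then show "finite (UNIV :: 'a idx set)" by (metis finite_imageI finite_lessThan)
qed

lemma card_idx: "CARD('n::finite idx) = CARD('n)"
  using type_definition.card[OF type_definition_idx] by simp

section \<open>Relabelling the coordinates\<close>

lemma greedy_energy_sequence_isometry:
  fixes f :: "'a::real_normed_vector \<Rightarrow> 'b::real_normed_vector"
  assumes iso: "\<And>v w. norm (f v - f w) = norm (v - w)" and n: "\<And>v. norm (f v) = norm v" and "surj f"
    and g: "greedy_energy_sequence s x"
  shows "greedy_energy_sequence s (\<lambda>k. f (x k))"
proof -
  have "f v = f w \<longleftrightarrow> v = w" for v w using iso[of v w] by auto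
  then have k: "riesz_kernel s (f v) (f w) = riesz_kernel s v w" for v w
    by (simp add: riesz_kernel_def iso)
  have "is_arg_min (\<lambda>y. \<Sum>i=1..N. riesz_kernel s y (f (x i))) (\<lambda>y. y \<in> sphere 0 1) (f (x (N + 1)))"
    if "is_arg_min (\<lambda>y. \<Sum>i=1..N. riesz_kernel s y (x i)) (\<lambda>y. y \<in> sphere 0 1) (x (N + 1))" for N
    unfolding is_arg_min_def
  proof (intro conjI notI)
    show "f (x (N + 1)) \<in> sphere 0 1" using that n by (simp add: is_arg_min_def)
    assume "\<exists>y. y \<in> sphere 0 1 \<and> (\<Sum>i=1..N. riesz_kernel s y (f (x i))) < (\<Sum>i=1..N. riesz_kernel s (f (x (N + 1))) (f (x i)))"
    then obtain y where y: "y \<in> sphere 0 1"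
      "(\<Sum>i=1..N. riesz_kernel s y (f (x i))) < (\<Sum>i=1..N. riesz_kernel s (f (x (N + 1))) (f (x i)))" by blast
    \<comment> \<open>Surjectivity pulls a better competitor back to the original sphere.\<close>
    obtain v where v: "y = f v" using \<open>surj f\<close> by blast
    show False using that y n unfolding is_arg_min_def v k by auto
  qed
  then show ?thesis using g n by (auto simp: greedy_energy_sequence_def)
qed

theorem theorem1p1:
  fixes d :: nat and s :: real and x :: "nat \<Rightarrow> real ^ 'n"
  assumes "CARD('n) = d + 1"
    and "d \<ge> 2"
    and "real d - 2 \<le> s"
    and "s < real d"
    and "greedy_energy_sequence s x"
  shows "well_separated d x"
proof -
  \<comment> \<open>Greediness and separation depend only on norms and distances, so any bijection
    of the indices will do.\<close>
  obtain b :: "'n idx \<Rightarrow> 'n" where b: "bij b"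
    using finite_same_card_bij[of "UNIV :: 'n idx set" "UNIV :: 'n set"] card_idx by auto
  define f where "f = (\<lambda>v::real^'n. (\<chi> k. v $ b k) :: real^'n idx)"
  have n: "norm (f v) = norm v" for v
    unfolding norm_vec_def L2_set_def f_def using sum.reindex_bij_betw[OF b, of "\<lambda>i. (norm (v $ i))\<^sup>2"] by simp
  have "f v - f w = f (v - w)" for v w by (simp add: f_def vec_eq_iff)
  then have iso: "norm (f v - f w) = norm (v - w)" for v w by (simp add: n)
  have "surj f"
  proof (rule surjI)
    fix u :: "real^'n idx"
    show "f (\<chi> i. u $ inv b i) = u" using b by (simp add: f_def vec_eq_iff bij_is_inj)
  qed
  then have g: "greedy_energy_sequence s (\<lambda>k. f (x k))"
    by (rule greedy_energy_sequence_isometry[OF iso n _ assms(5)])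
  have "well_separated d (\<lambda>k. f (x k))"
    by (rule well_separated_wellorder[OF _ assms(2-4) g]) (simp add: card_idx assms(1))
  then show ?thesis by (simp add: well_separated_def separation_distance_def iso)
qed

end
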